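(* Consider the two-color urn model described in the context, including the boundedness assumption $A_n\vee B_n\vee N_n\le C$. Suppose that $m_{A,n}\to m_A<+\infty$ and $m_{B,n}\to m_B<+\infty$ with $m_A>m_B$ and $$\sum_n \frac{|m_{A,n+1}m_B-m_A m_{B,n+1}|}{n}<+\infty .$$ Suppose moreover that $E[N_{n+1}\,|\,\mathcal{F}_n]\to N$ almost surely, where $N$ is a finite, strictly positive random variable. Then: (i) $(K_n)_n$ increases to $+\infty$ as $n^{m_B/m_A}$, that is, $K_n\uparrow+\infty$ almost surely and $K_n/n^{m_B/m_A}$ converges almost surely to a random variable with values in $(0,+\infty)$; (ii) $n^{1-m_B/m_A}(1-Z_n)\to \widetilde{Z}$ almost surely, where $\widetilde{Z}$ is a random variable taking values in $(0,+\infty)$; (iii) setting $N_{B,n}=\sum_{j=1}^n (N_j-X_j)$, we have $\dfrac{N_{B,n}}{n^{m_B/m_A}}\to \dfrac{m_A}{m_B}N\widetilde{Z}$ almost surely.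
   Context: Urn model. An urn initially contains $a\ge 1$ balls of color A and $b\ge 1$ balls of color B ($a,b$ integers). On a probability space $(\Omega,\mathcal{A},P)$ there are random variables $N_n,X_n,A_n,B_n$, $n\ge1$. At each time $n\ge 1$, $N_n$ balls are drawn simultaneously without replacement, $X_n$ of them are of color A, and they are returned to the urn together with $A_nX_n$ new balls of color A and $B_n(N_n-X_n)$ new balls of color B. Define $$H_n=a+\sum_{j=1}^n A_jX_j,\qquad K_n=b+\sum_{j=1}^n B_j(N_j-X_j),\qquad S_n=H_n+K_n,\qquad Z_n=H_n/S_n$$ (numbers of A balls, of B balls, of all balls, and proportion of A balls after step $n$; $H_0=a$, $K_0=b$). Let $\mathcal{F}_0$ be the trivial $\sigma$-field and $\mathcal{F}_n=\sigma(N_1,X_1,A_1,B_1,\dots,N_n,X_n,A_n,B_n)$ for $n\ge1$. For each $n\ge1$ it is assumed that: (A1) the conditional distribution of $N_n$ given $\mathcal{F}_{n-1}$ is concentrated on $\{1,\dots,S_{n-1}\}$ (and is otherwise arbitrary); (A2) the conditional distribution of $X_n$ given $\mathcal{F}_{n-1}\vee\sigma(N_n)$ is hypergeometric with parameters $N_n,S_{n-1},H_{n-1}$, i.e. the number of color-A balls in a sample without replacement of size $N_n$ from $S_{n-1}$ balls of which $H_{n-1}$ are of color A; (A3) the random vector $[A_n,B_n]$ takes values in $\{1,2,\dots\}^2$ and is independent of $\mathcal{F}_{n-1}\vee\sigma(N_n,X_n)$ (its joint distribution is otherwise arbitrary and may depend on $n$). Standing assumption: there is an integer constant $C$ with $A_n\vee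 B_n\vee N_n\le C$ for all $n$. Notation: $m_{A,n}=E[A_n]$, $m_{B,n}=E[B_n]$. *)

theory Defs
  imports "HOL-Probability.Probability"
begin

definition hypergeometric :: "nat \<Rightarrow> nat \<Rightarrow> nat \<Rightarrow> nat \<Rightarrow> real" where
  "hypergeometric n s h k =
     (if k \<le> n then real (h choose k) * real ((s - h) choose (n - k)) / real (s choose n) else 0)"

text \<open>
  Time starts at 1: the values of the processes at index 0 are never used.
  In \<open>urn_K\<close> the truncated subtraction on \<^typ>\<open>nat\<close> is harmless: the hypergeometric
  law of \<open>X\<close> in the model below forces \<open>X j \<le> N j\<close> almost surely.
\<close>

definition urn_H :: "nat \<Rightarrow> (nat \<Rightarrow> 'w \<Rightarrow> nat) \<Rightarrow> (nat \<Rightarrow> 'w \<Rightarrow> nat) \<Rightarrow> nat \<Rightarrow> 'w \<Rightarrow> nat" where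
  "urn_H a X A n \<omega> = a + (\<Sum>j=1..n. A j \<omega> * X j \<omega>)"

definition urn_K ::
  "nat \<Rightarrow> (nat \<Rightarrow> 'w \<Rightarrow> nat) \<Rightarrow> (nat \<Rightarrow> 'w \<Rightarrow> nat) \<Rightarrow> (nat \<Rightarrow> 'w \<Rightarrow> nat) \<Rightarrow> nat \<Rightarrow> 'w \<Rightarrow> nat" where
  "urn_K b N X B n \<omega> = b + (\<Sum>j=1..n. B j \<omega> * (N j \<omega> - X j \<omega>))"

definition urn_S ::
  "nat \<Rightarrow> nat \<Rightarrow> (nat \<Rightarrow> 'w \<Rightarrow> nat) \<Rightarrow> (nat \<Rightarrow> 'w \<Rightarrow> nat) \<Rightarrow> (nat \<Rightarrow> 'w \<Rightarrow> nat) \<Rightarrow> (nat \<Rightarrow> 'w \<Rightarrow> nat)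
    \<Rightarrow> nat \<Rightarrow> 'w \<Rightarrow> nat" where
  "urn_S a b N X A B n \<omega> = urn_H a X A n \<omega> + urn_K b N X B n \<omega>"

definition urn_Z ::
  "nat \<Rightarrow> nat \<Rightarrow> (nat \<Rightarrow> 'w \<Rightarrow> nat) \<Rightarrow> (nat \<Rightarrow> 'w \<Rightarrow> nat) \<Rightarrow> (nat \<Rightarrow> 'w \<Rightarrow> nat) \<Rightarrow> (nat \<Rightarrow> 'w \<Rightarrow> nat)
    \<Rightarrow> nat \<Rightarrow> 'w \<Rightarrow> real" where
  "urn_Z a b N X A B n \<omega> = real (urn_H a X A n \<omega>) / real (urn_S a b N X A B n \<omega>)"

definition preimages :: "'w measure \<Rightarrow> ('w \<Rightarrow> 'c) \<Rightarrow> 'w set set" where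
  "preimages M Y = {Y -` T \<inter> space M | T. True}"

text \<open>
  For a function \<open>Y\<close> into a countable set carrying its discrete \<open>\<sigma>\<close>-algebra,
  \<open>preimages M Y\<close> is the \<open>\<sigma>\<close>-algebra generated by \<open>Y\<close>.
\<close>

definition urn_F ::
  "'w measure \<Rightarrow> (nat \<Rightarrow> 'w \<Rightarrow> nat) \<Rightarrow> (nat \<Rightarrow> 'w \<Rightarrow> nat) \<Rightarrow> (nat \<Rightarrow> 'w \<Rightarrow> nat) \<Rightarrow> (nat \<Rightarrow> 'w \<Rightarrow> nat)
    \<Rightarrow> nat \<Rightarrow> 'w measure" where
  "urn_F M N X A B n =
     sigma (space M) (\<Union>j\<in>{1..n}. preimages M (\<lambda>\<omega>. (N j \<omega>, X j \<omega>, A j \<omega>, B j \<omega>)))"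

definition join_sigma :: "'w measure \<Rightarrow> ('w \<Rightarrow> 'c) \<Rightarrow> 'w measure" where
  "join_sigma F Y = sigma (space F) (sets F \<union> preimages F Y)"

definition cond_pr :: "'w measure \<Rightarrow> 'w measure \<Rightarrow> ('w \<Rightarrow> bool) \<Rightarrow> 'w \<Rightarrow> real" where
  "cond_pr M F P = real_cond_exp M F (indicat_real {\<omega> \<in> space M. P \<omega>})"

locale urn_model = prob_space M
  for M :: "'w measure" +
  fixes a b :: nat
    and N X A B :: "nat \<Rightarrow> 'w \<Rightarrow> nat"
  assumes a_ge_1: "1 \<le> a" and b_ge_1: "1 \<le> b"
    and N_measurable: "\<And>n. N (Suc n) \<in> measurable M (count_space UNIV)"
    and X_measurable: "\<And>n. X (Suc n) \<in> measurable M (count_space UNIV)"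
    and A_measurable: "\<And>n. A (Suc n) \<in> measurable M (count_space UNIV)"
    and B_measurable: "\<And>n. B (Suc n) \<in> measurable M (count_space UNIV)"
    and N_concentrated: "\<And>n. AE \<omega> in M. \<forall>k. k \<notin> {1..urn_S a b N X A B n \<omega>} \<longrightarrow>
          cond_pr M (urn_F M N X A B n) (\<lambda>\<omega>'. N (Suc n) \<omega>' = k) \<omega> = 0"
    and X_hypergeometric: "\<And>n. AE \<omega> in M. \<forall>k.
          cond_pr M (join_sigma (urn_F M N X A B n) (N (Suc n))) (\<lambda>\<omega>'. X (Suc n) \<omega>' = k) \<omega>
            = hypergeometric (N (Suc n) \<omega>) (urn_S a b N X A B n \<omega>) (urn_H a X A n \<omega>) k"
    and AB_positive: "\<And>n. AE \<omega> in M. 1 \<le> A (Suc n) \<omega> \<and> 1 \<le> B (Suc n) \<omega>"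
    and AB_indep: "\<And>n. indep_set
          (preimages M (\<lambda>\<omega>. (A (Suc n) \<omega>, B (Suc n) \<omega>)))
          (sets (join_sigma (urn_F M N X A B n) (\<lambda>\<omega>. (N (Suc n) \<omega>, X (Suc n) \<omega>))))"

end

theory Submission imports Defs begin

text \<open>
  Write \<open>Y = N - X\<close> and \<open>\<rho> = mB / mA\<close>. Given the past and the sample size \<open>N\<close>, the relative increments
  \<open>A X / H\<close> and \<open>B Y / K\<close> have means \<open>E[A] N / S\<close> and \<open>E[B] N / S\<close>, and they are square-summable along every path, because
  \<open>x / G\<^sup>2 \<le> (1 + c) (1 / G - 1 / (G + x))\<close> telescopes when \<open>0 \<le> x \<le> c\<close> and \<open>G \<ge> 1\<close>. So the
  compensated sums are \<open>L\<^sup>2\<close>-bounded martingales and converge almost surely, and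
  \<open>ln H\<close>, \<open>ln K\<close> differ from the sums of the relative increments by convergent terms. The summability
  hypothesis cancels the drifts in \<open>ln K - \<rho> ln H\<close>, which therefore converges. As \<open>\<rho> < 1\<close> and
  \<open>S\<^sub>n > n\<close>, this forces \<open>H \<rightarrow> \<infinity>\<close>, \<open>K \<rightarrow> \<infinity>\<close> and \<open>Z \<rightarrow> 1\<close>. Kronecker's lemma, with weights \<open>H\<close>, \<open>K\<close>
  and \<open>n\<close>, then gives \<open>H\<^sub>n \<sim> mA N n\<close> and \<open>\<Sum> Y \<sim> K / mB\<close>.
\<close>

section \<open>Deterministic asymptotics\<close>

text \<open>The first obstacle is that no lower bound on the growth of \<open>K\<close> is known in
  advance. The conditional variance of a relative increment of \<open>K\<close> is controlled by
  \<open>1 / (S * K)\<close>, whose summability presupposes such growth. The telescoping inequality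
  bounds the squares on each path by a constant that depends on the increment bound alone;
  integrating that constant settles the variances. The second obstacle is the random sample size:
  neither drift can be evaluated while the scale of \<open>S\<close> is unknown. Both carry the same
  factor \<open>N / S\<close>, however, and \<open>mB / mA\<close> is the multiple that leaves a
  remainder proportional to \<open>muA * mB - mA * muB\<close>, for which the crude bound
  \<open>N / S \<le> C / n\<close> is enough. The limit of the conditional means of \<open>N\<close>
  enters only afterwards, to fix the scale of \<open>H\<close>. All probability is thus confined to
  the convergence of four series. On a fixed path with \<open>v\<close> the limit of those means and
  \<open>q\<close> that of \<open>ln K - rho * ln H\<close>, the limit of
  \<open>K / n powr rho\<close> is \<open>exp q * (mA * v) powr rho\<close>; dividing it by
  \<open>mA * v\<close> gives the limit in (ii), dividing it by \<open>mB\<close> the limit in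
  (iii).\<close>

lemma toeplitz_null:
  fixes p x w :: "nat \<Rightarrow> real"
  assumes p: "\<And>j. 0 \<le> p j" and pw: "\<And>n. (\<Sum>j<n. p j) \<le> w n"
    and w: "filterlim w at_top sequentially" and x: "x \<longlonglongrightarrow> 0"
  shows "(\<lambda>n. (\<Sum>j<n. p j * x j) / w n) \<longlonglongrightarrow> 0"
proof (rule tendstoI)
  fix e :: real assume e: "0 < e"
  obtain m where m: "\<And>j. m \<le> j \<Longrightarrow> \<bar>x j\<bar> < e / 2"
    using LIMSEQ_D[OF x, of "e / 2"] e by auto
  define c where "c = (\<Sum>j<m. p j * \<bar>x j\<bar>)"
  \<comment> \<open>Beyond \<open>2 * c / e\<close> the fixed head \<open>c\<close> costs less than
    half of \<open>e * w n\<close>, and the tail costs at most the other half; the 1 keeps the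
    divisor positive.\<close>
  have "eventually (\<lambda>n. w n \<ge> max 1 (2 * c / e + 1)) sequentially"
    using w unfolding filterlim_at_top by blast
  then show "eventually (\<lambda>n. dist ((\<Sum>j<n. p j * x j) / w n) 0 < e) sequentially"
    using eventually_ge_at_top[of m]
  proof eventually_elim
    case (elim n)
    have split: "{..<n} = {..<m} \<union> {m..<n}" using elim by auto
    have "\<bar>\<Sum>j<n. p j * x j\<bar> \<le> (\<Sum>j<n. p j * \<bar>x j\<bar>)"
      by (rule order_trans[OF sum_abs]) (simp add: abs_mult p)
    also have "\<dots> = c + (\<Sum>j=m..<n. p j * \<bar>x j\<bar>)"
      unfolding c_def split by (rule sum.union_disjoint) auto
    also have "(\<Sum>j=m..<n. p j * \<bar>x j\<bar>) \<le> (\<Sum>j=m..<n. p j * (e / 2))"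
      using m p by (intro sum_mono mult_left_mono) (auto intro: less_imp_le)
    also have "\<dots> \<le> (\<Sum>j<n. p j * (e / 2))"
      using p e by (intro sum_mono2) auto
    also have "\<dots> = (\<Sum>j<n. p j) * (e / 2)" by (rule sum_distrib_right[symmetric])
    also have "\<dots> \<le> w n * (e / 2)"
      using pw e by (intro mult_right_mono) auto
    also have "c + w n * (e / 2) < e * w n"
    proof -
      have "2 * c / e < w n" using elim by simp
      then show ?thesis using e by (simp add: field_simps)
    qed
    finally have "\<bar>\<Sum>j<n. p j * x j\<bar> < e * w n" by simp
    moreover have "0 < w n" using elim by simp
    ultimately show ?case by (simp add: pos_divide_less_eq)
  qed
qed

text \<open>Summation by parts against the remainders \<open>r\<close> of the series. Since
  \<open>r\<close> is centered at its limit 0, the boundary term disappears after division by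
  \<open>w n\<close>, and what is left is a weighted sum of a null sequence whose weights, the
  increments of \<open>w\<close>, add up to at most \<open>w n\<close> because \<open>w 0\<close> is
  nonnegative.\<close>

lemma kronecker_null:
  fixes d w :: "nat \<Rightarrow> real"
  assumes d: "summable d" and inc: "incseq w" and w0: "0 \<le> w 0"
    and w: "filterlim w at_top sequentially"
  shows "(\<lambda>n. (\<Sum>j<n. w j * d j) / w n) \<longlonglongrightarrow> 0"
proof -
  define r where "r n = (\<Sum>j<n. d j) - suminf d" for n
  have r: "r \<longlonglongrightarrow> 0"
    unfolding r_def using summable_LIMSEQ[OF d] by (rule LIM_zero)
  have abel: "(\<Sum>j<n. w j * d j) = w n * r n - w 0 * r 0 - (\<Sum>j<n. (w (Suc j) - w j) * r (Suc j))" for n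
    by (induction n) (simp_all add: r_def algebra_simps)
  have "(\<lambda>n. (\<Sum>j<n. (w (Suc j) - w j) * r (Suc j)) / w n) \<longlonglongrightarrow> 0"
  proof (rule toeplitz_null[OF _ _ w])
    show "(\<lambda>j. r (Suc j)) \<longlonglongrightarrow> 0" using r by (rule LIMSEQ_Suc)
    show "(\<Sum>j<n. w (Suc j) - w j) \<le> w n" for n
      using w0 by (simp add: sum_lessThan_telescope)
  qed (use inc in \<open>simp add: incseq_SucD\<close>)
  moreover have "(\<lambda>n. w 0 * r 0 / w n) \<longlonglongrightarrow> 0"
    by (intro tendsto_divide_0[OF tendsto_const] filterlim_at_top_imp_at_infinity w)
  ultimately have "(\<lambda>n. r n - w 0 * r 0 / w n - (\<Sum>j<n. (w (Suc j) - w j) * r (Suc j)) / w n)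
      \<longlonglongrightarrow> 0 - 0 - 0"
    by (intro tendsto_diff r)
  moreover have "eventually (\<lambda>n. r n - w 0 * r 0 / w n
      - (\<Sum>j<n. (w (Suc j) - w j) * r (Suc j)) / w n = (\<Sum>j<n. w j * d j) / w n) sequentially"
    using w[unfolded filterlim_at_top, rule_format, of 1]
    by eventually_elim (simp add: abel diff_divide_distrib)
  ultimately show ?thesis by (auto intro: Lim_transform_eventually)
qed

text \<open>The bound involves neither \<open>n\<close> nor the speed at which \<open>G\<close>
  grows. Applied to every path of a random sequence, it therefore bounds second moments by
  integration of a constant.\<close>

lemma sum_square_increments_le:
  fixes G x :: "nat \<Rightarrow> real"
  assumes G0: "1 \<le> G 0" and G: "\<And>n. G (Suc n) = G n + x n"
    and x: "\<And>n. 0 \<le> x n" "\<And>n. x n \<le> c"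
  shows "(\<Sum>j<n. (x j / G j)\<^sup>2) \<le> c * (1 + c)"
proof -
  have c: "0 \<le> c" using x[of 0] by linarith
  have G1: "1 \<le> G n" for n by (induction n) (use G0 G x(1) in \<open>auto intro: add_increasing2\<close>)
  have step: "(x j / G j)\<^sup>2 \<le> c * (1 + c) * (1 / G j - 1 / G (Suc j))" for j
  proof -
    have g: "1 \<le> G j" "0 < G j" using G1[of j] by auto
    \<comment> \<open>Here \<open>G \<ge> 1\<close> enters: a bounded increment is at most a fixed
      multiple of the current value, so \<open>G j\<close> and \<open>G (Suc j)\<close> are
      comparable and one factor of the square may be replaced.\<close>
    have "c * 1 \<le> c * G j" using g c by (intro mult_left_mono)
    then have s: "G j + x j \<le> (1 + c) * G j" using x(2)[of j] by (simp add: distrib_right)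
    have "(x j / G j)\<^sup>2 = x j * (x j / (G j * G j))" by (simp add: power2_eq_square)
    also have "\<dots> \<le> c * ((1 + c) * x j / (G j * (G j + x j)))"
    proof (rule mult_mono)
      have "x j / (G j * G j) = (1 + c) * x j / (G j * ((1 + c) * G j))" using g c by simp
      also have "\<dots> \<le> (1 + c) * x j / (G j * (G j + x j))"
        using s g x(1)[of j] c by (intro divide_left_mono mult_left_mono mult_pos_pos) auto
      finally show "x j / (G j * G j) \<le> (1 + c) * x j / (G j * (G j + x j))" .
    qed (use x[of j] g c in auto)
    also have "\<dots> = c * (1 + c) * (x j / (G j * (G j + x j)))" by simp
    also have "x j / (G j * (G j + x j)) = 1 / G j - 1 / G (Suc j)"
      using g x(1)[of j] by (simp add: G diff_frac_eq add_pos_nonneg)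
    finally show ?thesis .
  qed
  have "(\<Sum>j<n. (x j / G j)\<^sup>2) \<le> (\<Sum>j<n. c * (1 + c) * (1 / G j - 1 / G (Suc j)))"
    by (intro sum_mono step)
  also have "\<dots> = c * (1 + c) * (1 / G 0 - 1 / G n)"
    by (simp only: sum_distrib_left[symmetric] sum_lessThan_telescope'[of "\<lambda>j. 1 / G j"])
  also have "\<dots> \<le> c * (1 + c) * 1"
  proof (rule mult_left_mono)
    have "1 / G 0 \<le> 1" "0 \<le> 1 / G n" using G1[of n] G0 by simp_all
    then show "1 / G 0 - 1 / G n \<le> 1" by linarith
  qed (use c in simp)
  finally show ?thesis by simp
qed

text \<open>For \<open>t \<ge> 0\<close> the error of replacing \<open>ln (1 + t)\<close> by
  \<open>t\<close> is at most the square of \<open>t\<close>: a standard estimate up to 1, and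
  beyond 1 the lower bound is negative while the logarithm is not. With \<open>t = x j / G j\<close>
  these squares are summable.\<close>

lemma convergent_ln_minus_sum:
  fixes G x :: "nat \<Rightarrow> real"
  assumes G0: "1 \<le> G 0" and G: "\<And>n. G (Suc n) = G n + x n"
    and x: "\<And>n. 0 \<le> x n" "\<And>n. x n \<le> c"
  shows "convergent (\<lambda>n. ln (G n) - (\<Sum>j<n. x j / G j))"
proof -
  have G1: "1 \<le> G n" for n by (induction n) (use G0 G x(1) in \<open>auto intro: add_increasing2\<close>)
  have "summable (\<lambda>j. (x j / G j)\<^sup>2)"
    using sum_square_increments_le[OF assms] by (intro summableI_nonneg_bounded) auto
  moreover have "norm (ln (G (Suc j)) - ln (G j) - x j / G j) \<le> (x j / G j)\<^sup>2" for j
  proof -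
    have g: "0 < G j" "0 < G (Suc j)" using G1[of j] G1[of "Suc j"] by auto
    have s: "0 \<le> x j / G j" using x(1) g by simp
    have "ln (G (Suc j)) - ln (G j) = ln (1 + x j / G j)"
      using g ln_div[of "G (Suc j)" "G j"] by (simp add: G add_divide_distrib)
    moreover have "ln (1 + x j / G j) \<le> x j / G j" by (rule ln_add_one_self_le_self[OF s])
    moreover have "x j / G j - (x j / G j)\<^sup>2 \<le> ln (1 + x j / G j)"
    proof -
      have "t - t\<^sup>2 \<le> ln (1 + t)" if "0 \<le> t" for t :: real
      proof (cases "t \<le> 1")
        case True then show ?thesis using ln_one_plus_pos_lower_bound that by blast
      next
        case False
        then have "t - t\<^sup>2 \<le> 0" by (simp add: power2_eq_square)
        also have "0 \<le> ln (1 + t)" using that by simp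
        finally show ?thesis .
      qed
      then show ?thesis using s by blast
    qed
    ultimately show ?thesis by auto
  qed
  ultimately have "summable (\<lambda>j. ln (G (Suc j)) - ln (G j) - x j / G j)"
    by (rule summable_comparison_test'[where N = 0])
  then have "convergent (\<lambda>n. \<Sum>j<n. ln (G (Suc j)) - ln (G j) - x j / G j)"
    by (simp add: summable_iff_convergent)
  also have "(\<lambda>n. \<Sum>j<n. ln (G (Suc j)) - ln (G j) - x j / G j)
      = (\<lambda>n. (ln (G n) - (\<Sum>j<n. x j / G j)) + - ln (G 0))"
  proof
    show "(\<Sum>j<n. ln (G (Suc j)) - ln (G j) - x j / G j)
      = (ln (G n) - (\<Sum>j<n. x j / G j)) + - ln (G 0)" for n
      by (induction n) simp_all
  qed
  finally have "convergent (\<lambda>n. ((ln (G n) - (\<Sum>j<n. x j / G j)) + - ln (G 0)) - (- ln (G 0)))"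
    by (intro convergent_diff convergent_const)
  then show ?thesis by simp
qed

section \<open>Pathwise recursion of the urn composition\<close>

lemma real_plus_1_at_top: "filterlim (\<lambda>n. real n + 1) at_top sequentially"
  using filterlim_tendsto_add_at_top[OF tendsto_const[of 1] filterlim_real_sequentially]
  by (simp add: add.commute)

text \<open>Indices are shifted: entry \<open>n\<close> of \<open>A\<close>, \<open>B\<close>,
  \<open>N\<close>, \<open>X\<close>, \<open>Y\<close> belongs to draw number \<open>n + 1\<close>,
  so that \<open>H n\<close>, \<open>K n\<close>, \<open>S n\<close> describe the urn from which
  that draw is made. \<open>Y\<close> is a real sequence of its own, which keeps truncated
  subtraction out of the calculations.\<close>

locale urn_growth =
  fixes A B N X Y H K S :: "nat \<Rightarrow> real" and C :: real
  assumes A: "\<And>n. 1 \<le> A n" "\<And>n. A n \<le> C"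
    and B: "\<And>n. 1 \<le> B n" "\<And>n. B n \<le> C"
    and N: "\<And>n. 1 \<le> N n" "\<And>n. N n \<le> C"
    and XY: "\<And>n. 0 \<le> X n" "\<And>n. 0 \<le> Y n" "\<And>n. X n + Y n = N n"
    and H0: "1 \<le> H 0" and H: "\<And>n. H (Suc n) = H n + A n * X n"
    and K0: "1 \<le> K 0" and K: "\<And>n. K (Suc n) = K n + B n * Y n"
    and S: "\<And>n. S n = H n + K n"
begin

lemma C_ge_1: "1 \<le> C" using A[of 0] by linarith

lemma AX_bounds: "0 \<le> A n * X n" "A n * X n \<le> C * C"
  using A[of n] N[of n] XY(1-3)[of n] C_ge_1 by (auto intro!: mult_mono)

lemma BY_bounds: "0 \<le> B n * Y n" "B n * Y n \<le> C * C" "Y n \<le> B n * Y n"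
  using B[of n] N[of n] XY(1-3)[of n] C_ge_1 mult_right_mono[of 1 "B n" "Y n"] by (auto intro!: mult_mono)

lemma H_ge: "1 \<le> H n"
  by (induction n) (use H0 H AX_bounds(1) in \<open>auto intro: add_increasing2\<close>)

lemma K_ge: "1 \<le> K n"
  by (induction n) (use K0 K BY_bounds(1) in \<open>auto intro: add_increasing2\<close>)

lemma incseq_H: "incseq H" and incseq_K: "incseq K"
  using H K AX_bounds(1) BY_bounds(1) by (auto intro!: incseq_SucI)

lemma S_ge: "real n + 1 \<le> S n"
proof (induction n)
  case 0 then show ?case using H0 K0 by (simp add: S)
next
  case (Suc n)
  have "X n \<le> A n * X n" using A(1)[of n] XY(1)[of n] mult_right_mono[of 1 "A n" "X n"] by simp
  then have "1 \<le> A n * X n + B n * Y n" using BY_bounds(3)[of n] N(1)[of n] XY(3)[of n] by linarith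
  then show ?case using Suc by (simp add: S H K)
qed

lemma N_over_S:
  assumes "0 \<le> m" "m \<le> C"
  shows "0 \<le> m * N n / S n" "m * N n / S n \<le> C * C / (real n + 1)"
proof -
  have p: "0 < S n" using S_ge[of n] by linarith
  show "0 \<le> m * N n / S n" using assms N(1)[of n] p by simp
  show "m * N n / S n \<le> C * C / (real n + 1)"
    using assms N[of n] S_ge[of n] C_ge_1 by (intro frac_le mult_mono) auto
qed

lemma le_C_square_mult: "0 \<le> r \<Longrightarrow> r \<le> C * C * r"
  using mult_mono[OF C_ge_1 C_ge_1] C_ge_1 mult_right_mono[of 1 "C * C" r] by simp

text \<open>This bound and the next two have the common shape
  \<open>c * (x / G) + c / (n + 1)\<close> with \<open>c = C * C\<close>, where the same
  \<open>c\<close> also bounds the increment \<open>x\<close>. That is the form in which the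
  martingale criterion takes them; the number \<open>m\<close> stands for the mean of
  \<open>A\<close> or \<open>B\<close>.\<close>

lemma H_increment_bound:
  assumes "0 \<le> m" "m \<le> C"
  shows "\<bar>A n * X n / H n - m * N n / S n\<bar> \<le> C * C * (A n * X n / H n) + C * C / (real n + 1)"
proof -
  have "0 \<le> A n * X n / H n" using AX_bounds(1)[of n] H_ge[of n] by simp
  then show ?thesis using N_over_S[OF assms, of n] le_C_square_mult[of "A n * X n / H n"] by linarith
qed

lemma K_increment_bound:
  assumes "0 \<le> m" "m \<le> C"
  shows "\<bar>B n * Y n / K n - m * N n / S n\<bar> \<le> C * C * (B n * Y n / K n) + C * C / (real n + 1)"
proof -
  have "0 \<le> B n * Y n / K n" using BY_bounds(1)[of n] K_ge[of n] by simp
  then show ?thesis using N_over_S[OF assms, of n] le_C_square_mult[of "B n * Y n / K n"] by linarith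
qed

lemma B_fluctuation_bound:
  assumes "0 \<le> m" "m \<le> C"
  shows "\<bar>(B n - m) * Y n / K n\<bar> \<le> C * C * (B n * Y n / K n) + C * C / (real n + 1)"
proof -
  have "\<bar>B n - m\<bar> \<le> C" using B[of n] assms by linarith
  moreover have "0 \<le> Y n / K n" using XY(2)[of n] K_ge[of n] by simp
  ultimately have "\<bar>B n - m\<bar> * (Y n / K n) \<le> C * (Y n / K n)" by (rule mult_right_mono)
  also have "\<dots> \<le> C * (B n * Y n / K n)"
    using BY_bounds(3)[of n] K_ge[of n] C_ge_1 by (intro mult_left_mono divide_right_mono) auto
  also have "\<dots> \<le> C * C * (B n * Y n / K n)"
    using C_ge_1 BY_bounds(1)[of n] K_ge[of n] by (intro mult_right_mono) auto
  finally have "\<bar>(B n - m) * Y n / K n\<bar> \<le> C * C * (B n * Y n / K n)"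
    using XY(2)[of n] K_ge[of n] by (simp add: abs_mult)
  moreover have "0 \<le> C * C / (real n + 1)" by simp
  ultimately show ?thesis by linarith
qed

end

text \<open>\<open>D1\<close> to \<open>D4\<close> are the four series whose convergence probability
  theory has to supply. \<open>D1\<close> and \<open>D2\<close> compensate color and replacement
  together. \<open>D3\<close> replaces only \<open>B\<close> by its mean and keeps the actual draw
  \<open>Y\<close>, as is needed to count draws from the number of balls added; \<open>D4\<close>
  compensates the sample sizes for their average.\<close>

locale urn_path = urn_growth A B N X Y H K S C
  for A B N X Y H K S :: "nat \<Rightarrow> real" and C :: real +
  fixes nu muA muB :: "nat \<Rightarrow> real" and mA mB v :: real
  assumes nu: "nu \<longlonglongrightarrow> v" and v: "0 < v"
    and muA: "muA \<longlonglongrightarrow> mA" and muB: "muB \<longlonglongrightarrow> mB"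
    and mB: "0 < mB" and mAB: "mB < mA"
    and drift: "summable (\<lambda>n. \<bar>muA n * mB - mA * muB n\<bar> / real n)"
    and D1: "summable (\<lambda>n. A n * X n / H n - muA n * N n / S n)"
    and D2: "summable (\<lambda>n. B n * Y n / K n - muB n * N n / S n)"
    and D3: "summable (\<lambda>n. (B n - muB n) * Y n / K n)"
    and D4: "summable (\<lambda>n. (N n - nu n) / (real n + 1))"
begin

section \<open>Growth rates along a fixed path\<close>

definition "rho = mB / mA"

lemma rho_bounds: "0 < rho" "rho < 1" "0 < mA"
  using mB mAB by (auto simp: rho_def)

text \<open>The logarithms differ from their compensators by convergent terms, so only the combined
  drift \<open>(muB - rho * muA) * N / S\<close> remains. Its first factor is the quantity in
  \<open>drift\<close> divided by \<open>-mA\<close>, and the second is at most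
  \<open>C / n\<close>.\<close>

lemma convergent_ln_K_minus_ln_H: "convergent (\<lambda>n. ln (K n) - rho * ln (H n))"
proof -
  have cH: "convergent (\<lambda>n. ln (H n) - (\<Sum>j<n. A j * X j / H j))"
    by (rule convergent_ln_minus_sum[OF H0 H AX_bounds])
  have cK: "convergent (\<lambda>n. ln (K n) - (\<Sum>j<n. B j * Y j / K j))"
    by (rule convergent_ln_minus_sum[OF K0 K BY_bounds(1,2)])
  have "summable (\<lambda>n. (muB n - rho * muA n) * N n / S n)"
  proof (rule summable_comparison_test)
    show "summable (\<lambda>n. \<bar>muA n * mB - mA * muB n\<bar> / real n * (C / mA))"
      by (rule summable_mult2[OF drift])
    \<comment> \<open>Index 0 is left out because division by 0 makes the comparison term vanish
      there.\<close>
    have "norm ((muB n - rho * muA n) * N n / S n)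
        \<le> \<bar>muA n * mB - mA * muB n\<bar> / real n * (C / mA)" if "1 \<le> n" for n
    proof -
      have "muB n - rho * muA n = - (muA n * mB - mA * muB n) / mA"
        using rho_bounds by (simp add: rho_def field_simps)
      then have e: "\<bar>muB n - rho * muA n\<bar> = \<bar>muA n * mB - mA * muB n\<bar> / mA"
        using rho_bounds by (simp add: abs_minus_commute)
      have "N n / S n \<le> C / real n"
        using N[of n] S_ge[of n] C_ge_1 that by (intro frac_le) auto
      then have "\<bar>muB n - rho * muA n\<bar> * (N n / S n)
          \<le> \<bar>muA n * mB - mA * muB n\<bar> / mA * (C / real n)"
        unfolding e using rho_bounds by (intro mult_left_mono) auto
      then show ?thesis using N(1)[of n] S_ge[of n] by (simp add: abs_mult mult.commute)
    qed
    then show "\<exists>m. \<forall>n\<ge>m. norm ((muB n - rho * muA n) * N n / S n)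
        \<le> \<bar>muA n * mB - mA * muB n\<bar> / real n * (C / mA)" by blast
  qed
  with D1 D2 have "convergent (\<lambda>n. (\<Sum>j<n. A j * X j / H j - muA j * N j / S j))"
    "convergent (\<lambda>n. (\<Sum>j<n. B j * Y j / K j - muB j * N j / S j))"
    "convergent (\<lambda>n. (\<Sum>j<n. (muB j - rho * muA j) * N j / S j))"
    by (auto simp: summable_iff_convergent)
  then have "convergent (\<lambda>n. (ln (K n) - (\<Sum>j<n. B j * Y j / K j))
      - rho * (ln (H n) - (\<Sum>j<n. A j * X j / H j))
      + (\<Sum>j<n. B j * Y j / K j - muB j * N j / S j)
      - rho * (\<Sum>j<n. A j * X j / H j - muA j * N j / S j)
      + (\<Sum>j<n. (muB j - rho * muA j) * N j / S j))"
    by (intro convergent_add[OF convergent_diff[OF convergent_add[OF convergent_diff]]]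
        convergent_mult[OF convergent_const] cH cK)
  also have "(\<lambda>n. (ln (K n) - (\<Sum>j<n. B j * Y j / K j))
      - rho * (ln (H n) - (\<Sum>j<n. A j * X j / H j))
      + (\<Sum>j<n. B j * Y j / K j - muB j * N j / S j)
      - rho * (\<Sum>j<n. A j * X j / H j - muA j * N j / S j)
      + (\<Sum>j<n. (muB j - rho * muA j) * N j / S j)) = (\<lambda>n. ln (K n) - rho * ln (H n))"
  proof
    fix n
    have "(\<Sum>j<n. (muB j - rho * muA j) * N j / S j)
        = (\<Sum>j<n. muB j * N j / S j) - rho * (\<Sum>j<n. muA j * N j / S j)"
      by (induction n) (simp_all add: algebra_simps diff_divide_distrib)
    then show "(ln (K n) - (\<Sum>j<n. B j * Y j / K j))
      - rho * (ln (H n) - (\<Sum>j<n. A j * X j / H j))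
      + (\<Sum>j<n. B j * Y j / K j - muB j * N j / S j)
      - rho * (\<Sum>j<n. A j * X j / H j - muA j * N j / S j)
      + (\<Sum>j<n. (muB j - rho * muA j) * N j / S j) = ln (K n) - rho * ln (H n)"
      by (simp add: sum_subtractf algebra_simps)
  qed
  finally show ?thesis .
qed

definition "q = lim (\<lambda>n. ln (K n) - rho * ln (H n))"

lemma ln_K_minus_ln_H_limit: "(\<lambda>n. ln (K n) - rho * ln (H n)) \<longlonglongrightarrow> q"
  using convergent_ln_K_minus_ln_H by (simp add: q_def convergent_LIMSEQ_iff)

text \<open>A bounded log difference together with \<open>rho < 1\<close> gives
  \<open>K n \<le> exp Q * H n\<close>. Then \<open>H\<close> carries a fixed fraction of
  \<open>S\<close>, which exceeds every bound.\<close>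

lemma H_at_top: "filterlim H at_top sequentially"
proof -
  obtain Q where Q: "\<And>n. \<bar>ln (K n) - rho * ln (H n)\<bar> \<le> Q"
    using convergent_imp_Bseq[OF convergent_ln_K_minus_ln_H] by (auto simp: Bseq_def)
  have "(real n + 1) / (1 + exp Q) \<le> H n" for n
  proof -
    have "rho * ln (H n) \<le> ln (H n)"
      using rho_bounds H_ge[of n] by (intro mult_left_le_one_le) auto
    then have "ln (K n) \<le> Q + ln (H n)" using Q[of n] by linarith
    then have "exp (ln (K n)) \<le> exp (Q + ln (H n))" by simp
    then have "K n \<le> exp Q * H n" using H_ge[of n] K_ge[of n] by (simp add: exp_add)
    then have "real n + 1 \<le> (1 + exp Q) * H n" using S_ge[of n] by (simp add: S algebra_simps)
    then show ?thesis
      by (subst pos_divide_le_eq) (auto simp: mult.commute intro: add_pos_pos)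
  qed
  moreover have "filterlim (\<lambda>n. inverse (1 + exp Q) * (real n + 1)) at_top sequentially"
    by (intro filterlim_tendsto_pos_mult_at_top[OF tendsto_const _ real_plus_1_at_top])
      (simp add: add_pos_pos)
  ultimately show ?thesis
    by (elim filterlim_at_top_mono) (simp add: divide_inverse mult.commute)
qed

lemma ln_H_at_top: "filterlim (\<lambda>n. ln (H n)) at_top sequentially"
  by (rule filterlim_compose[OF ln_at_top H_at_top])

lemma K_at_top: "filterlim K at_top sequentially"
proof -
  have "filterlim (\<lambda>n. rho * ln (H n)) at_top sequentially"
    using rho_bounds by (intro filterlim_tendsto_pos_mult_at_top[OF tendsto_const _ ln_H_at_top])
  then have "filterlim (\<lambda>n. (ln (K n) - rho * ln (H n)) + rho * ln (H n)) at_top sequentially"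
    by (rule filterlim_tendsto_add_at_top[OF ln_K_minus_ln_H_limit])
  then have "filterlim (\<lambda>n. exp (ln (K n))) at_top sequentially"
    by (intro filterlim_compose[OF exp_at_top]) simp
  moreover have "exp (ln (K n)) = K n" for n using K_ge[of n] by simp
  ultimately show ?thesis by simp
qed

text \<open>The logarithm of the quotient is a convergent sequence minus
  \<open>(1 - rho) * ln (H n)\<close>, and the strict inequality \<open>rho < 1\<close> sends it to
  minus infinity.\<close>

lemma K_over_H: "(\<lambda>n. K n / H n) \<longlonglongrightarrow> 0"
proof -
  have "filterlim (\<lambda>n. (1 - rho) * ln (H n)) at_top sequentially"
    by (rule filterlim_tendsto_pos_mult_at_top[OF tendsto_const _ ln_H_at_top]) (use rho_bounds(2) in simp)
  then have "filterlim (\<lambda>n. - (ln (K n) - rho * ln (H n)) + (1 - rho) * ln (H n)) at_top sequentially"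
    by (rule filterlim_tendsto_add_at_top[OF tendsto_minus[OF ln_K_minus_ln_H_limit]])
  then have "filterlim (\<lambda>n. - (- (ln (K n) - rho * ln (H n)) + (1 - rho) * ln (H n))) at_bot sequentially"
    by (rule filterlim_compose[OF filterlim_uminus_at_bot_at_top])
  then have "filterlim (\<lambda>n. ln (K n) - ln (H n)) at_bot sequentially"
    by (simp add: left_diff_distrib)
  then have "(\<lambda>n. exp (ln (K n) - ln (H n))) \<longlonglongrightarrow> 0"
    by (rule filterlim_compose[OF exp_at_bot])
  moreover have "exp (ln (K n) - ln (H n)) = K n / H n" for n
    using H_ge[of n] K_ge[of n] by (simp add: exp_diff)
  ultimately show ?thesis by simp
qed

lemma Z_limit: "(\<lambda>n. H n / S n) \<longlonglongrightarrow> 1"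
proof -
  have "(\<lambda>n. 1 / (1 + K n / H n)) \<longlonglongrightarrow> 1 / (1 + 0)"
    by (intro tendsto_intros K_over_H) auto
  moreover have "1 / (1 + K n / H n) = H n / S n" for n
    using H_ge[of n] K_ge[of n] by (simp add: S field_simps)
  ultimately show ?thesis by simp
qed

text \<open>Split \<open>N j\<close> into \<open>N j - nu j\<close>, \<open>nu j - v\<close> and
  \<open>v\<close>: Kronecker's lemma on \<open>D4\<close> removes the first part, averaging of a
  null sequence the second.\<close>

lemma N_average: "(\<lambda>n. (\<Sum>j<n. N j) / (real n + 1)) \<longlonglongrightarrow> v"
proof -
  have "(\<lambda>n. (\<Sum>j<n. (real j + 1) * ((N j - nu j) / (real j + 1))) / (real n + 1)) \<longlonglongrightarrow> 0"
    by (rule kronecker_null[OF D4 _ _ real_plus_1_at_top]) (auto simp: incseq_def)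
  moreover have "(\<Sum>j<n. (real j + 1) * ((N j - nu j) / (real j + 1))) = (\<Sum>j<n. N j - nu j)" for n
    by (intro sum.cong) (auto simp: field_simps)
  moreover have "(\<lambda>n. (\<Sum>j<n. 1 * (nu j - v)) / (real n + 1)) \<longlonglongrightarrow> 0"
    using nu by (intro toeplitz_null real_plus_1_at_top) (auto simp: LIM_zero_iff)
  moreover have "(\<lambda>n. real n * v / (real n + 1)) \<longlonglongrightarrow> v"
  proof -
    have "(\<lambda>n. v * (real n / real (Suc n))) \<longlonglongrightarrow> v * 1"
      by (intro tendsto_intros LIMSEQ_n_over_Suc_n)
    then show ?thesis by (simp add: field_simps)
  qed
  ultimately have "(\<lambda>n. (\<Sum>j<n. N j - nu j) / (real n + 1) + (\<Sum>j<n. 1 * (nu j - v)) / (real n + 1)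
      + real n * v / (real n + 1)) \<longlonglongrightarrow> 0 + 0 + v"
    by (intro tendsto_add) simp_all
  then show ?thesis
    by (simp add: add_divide_distrib[symmetric] sum_subtractf)
qed

text \<open>\<open>P\<close> is the compensator of \<open>H\<close>. Since \<open>H / S\<close>
  tends to 1, the averages of \<open>N\<close> determine \<open>P / n\<close>. Kronecker's lemma on
  \<open>D1\<close>, with \<open>H\<close> itself as weight, yields
  \<open>P / H \<longlonglongrightarrow> 1\<close>; it asks only that \<open>H\<close> increase to
  infinity, so no rate for \<open>H\<close> is presupposed.\<close>

lemma H_linear: "(\<lambda>n. H n / (real n + 1)) \<longlonglongrightarrow> mA * v"
proof -
  define P where "P n = (\<Sum>j<n. muA j * N j * (H j / S j))" for n
  \<comment> \<open>The factor \<open>C\<close> in the denominator makes it dominate the partial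
    sums of the weights \<open>N j\<close>; it is multiplied back afterwards.\<close>
  have "(\<lambda>n. (\<Sum>j<n. N j * (muA j * (H j / S j) - mA)) / (C * (real n + 1))) \<longlonglongrightarrow> 0"
  proof (rule toeplitz_null)
    show "0 \<le> N j" for j using N(1)[of j] by linarith
    show "(\<Sum>j<n. N j) \<le> C * (real n + 1)" for n
      using sum_bounded_above[of "{..<n}" N C] N(2) C_ge_1 by (simp add: algebra_simps)
    show "filterlim (\<lambda>n. C * (real n + 1)) at_top sequentially"
      using C_ge_1 by (intro filterlim_tendsto_pos_mult_at_top[OF tendsto_const _ real_plus_1_at_top]) auto
    show "(\<lambda>j. muA j * (H j / S j) - mA) \<longlonglongrightarrow> 0"
      using tendsto_mult[OF muA Z_limit] by (simp add: LIM_zero_iff)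
  qed
  then have "(\<lambda>n. C * ((\<Sum>j<n. N j * (muA j * (H j / S j) - mA)) / (C * (real n + 1)))
      + mA * ((\<Sum>j<n. N j) / (real n + 1))) \<longlonglongrightarrow> C * 0 + mA * v"
    by (intro tendsto_intros N_average)
  moreover have "C * ((\<Sum>j<n. N j * (muA j * (H j / S j) - mA)) / (C * (real n + 1)))
      + mA * ((\<Sum>j<n. N j) / (real n + 1)) = P n / (real n + 1)" for n
  proof -
    have "(\<Sum>j<n. N j * (muA j * (H j / S j) - mA)) + mA * (\<Sum>j<n. N j) = P n"
      unfolding P_def sum_distrib_left sum.distrib[symmetric]
      by (intro sum.cong) (auto simp: algebra_simps)
    then show ?thesis using C_ge_1 by (simp add: add_divide_distrib[symmetric])
  qed
  ultimately have P: "(\<lambda>n. P n / (real n + 1)) \<longlonglongrightarrow> mA * v" by simp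
  have "(\<lambda>n. (\<Sum>j<n. H j * (A j * X j / H j - muA j * N j / S j)) / H n) \<longlonglongrightarrow> 0"
    using H0 by (intro kronecker_null D1 incseq_H H_at_top) auto
  moreover have "(\<Sum>j<n. H j * (A j * X j / H j - muA j * N j / S j)) = H n - H 0 - P n" for n
  proof (induction n)
    case (Suc n)
    then show ?case using H_ge[of n] by (simp add: P_def H algebra_simps)
  qed (simp add: P_def)
  moreover have "(\<lambda>n. H 0 / H n) \<longlonglongrightarrow> 0"
    by (intro tendsto_divide_0[OF tendsto_const] filterlim_at_top_imp_at_infinity H_at_top)
  ultimately have "(\<lambda>n. 1 - H 0 / H n - (H n - H 0 - P n) / H n) \<longlonglongrightarrow> 1 - 0 - 0"
    by (intro tendsto_intros) simp_all
  moreover have "1 - H 0 / H n - (H n - H 0 - P n) / H n = P n / H n" for n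
    using H_ge[of n] by (simp add: field_simps)
  ultimately have "(\<lambda>n. P n / H n) \<longlonglongrightarrow> 1" by simp
  from tendsto_divide[OF P this]
  have "(\<lambda>n. P n / (real n + 1) / (P n / H n)) \<longlonglongrightarrow> mA * v" by simp
  \<comment> \<open>The identity cancels \<open>P n\<close>, which is 0 at the start; it is
    eventually positive because \<open>P n / H n\<close> tends to 1.\<close>
  moreover have "eventually (\<lambda>n. P n / (real n + 1) / (P n / H n) = H n / (real n + 1)) sequentially"
    using order_tendstoD(1)[OF \<open>(\<lambda>n. P n / H n) \<longlonglongrightarrow> 1\<close>, of 0, simplified]
    by eventually_elim auto
  ultimately show ?thesis by (rule Lim_transform_eventually)
qed

section \<open>Power-law limits\<close>

lemma H_over_n: "(\<lambda>n. H n / real n) \<longlonglongrightarrow> mA * v"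
proof -
  have "(\<lambda>n. H n / (real n + 1) * (real (Suc n) / real n)) \<longlonglongrightarrow> mA * v * 1"
    by (intro tendsto_mult H_linear LIMSEQ_Suc_n_over_n)
  moreover have "H n / (real n + 1) * (real (Suc n) / real n) = H n / real n" for n
  proof -
    have "real (Suc n) = real n + 1" "real n + 1 \<noteq> 0" by simp_all
    then show ?thesis by (metis times_divide_times_eq nonzero_mult_divide_mult_cancel_left mult.commute)
  qed
  ultimately show ?thesis by simp
qed

text \<open>The limit of \<open>K n / n powr rho\<close>: \<open>K n\<close> behaves like
  \<open>exp q * H n powr rho\<close>, and \<open>H n\<close> like
  \<open>mA * v * n\<close>.\<close>

definition "L = exp q * (mA * v) powr rho"

lemma L_pos: "0 < L"
  using rho_bounds v by (simp add: L_def)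

lemma K_power: "(\<lambda>n. K n / real n powr rho) \<longlonglongrightarrow> L"
proof -
  have "(\<lambda>n. exp (ln (K n) - rho * ln (H n)) * (H n / real n) powr rho) \<longlonglongrightarrow> L"
    unfolding L_def using rho_bounds v by (intro tendsto_intros ln_K_minus_ln_H_limit H_over_n) auto
  \<comment> \<open>The identity also holds at index 0, where division by 0 and a power of 0 make
    both sides 0.\<close>
  moreover have "exp (ln (K n) - rho * ln (H n)) * (H n / real n) powr rho = K n / real n powr rho" for n
    using H_ge[of n] K_ge[of n] by (simp add: exp_diff powr_divide powr_def[of "H n"])
  ultimately show ?thesis by simp
qed

text \<open>The proportion of the other color is \<open>K / S = (K / H) * (H / S)\<close>, and the
  last factor tends to 1.\<close>

lemma one_minus_Z_power: "(\<lambda>n. real n powr (1 - rho) * (1 - H n / S n)) \<longlonglongrightarrow> L / (mA * v)"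
proof -
  have "(\<lambda>n. K n / real n powr rho / (H n / real n) * (H n / S n)) \<longlonglongrightarrow> L / (mA * v) * 1"
    using rho_bounds v by (intro tendsto_intros K_power H_over_n Z_limit) auto
  moreover have "eventually (\<lambda>n. K n / real n powr rho / (H n / real n) * (H n / S n)
      = real n powr (1 - rho) * (1 - H n / S n)) sequentially"
    using eventually_gt_at_top[of 0]
  proof eventually_elim
    case (elim n)
    have "1 - H n / S n = K n / S n" using H_ge[of n] K_ge[of n] by (simp add: S field_simps)
    moreover have "real n powr (1 - rho) = real n / real n powr rho"
      using elim by (simp add: powr_diff)
    ultimately show ?case using H_ge[of n] by simp
  qed
  ultimately show ?thesis by (auto intro: Lim_transform_eventually)
qed

text \<open>\<open>K n - K 0\<close> equals \<open>mB\<close> times the number of draws, plus the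
  error of \<open>muB\<close> against \<open>mB\<close>, plus the fluctuation of \<open>B\<close>.
  Both corrections are negligible against \<open>K\<close>: the first because the total of
  \<open>Y\<close> is at most \<open>K\<close>, the second by Kronecker's lemma on
  \<open>D3\<close>.\<close>

lemma Y_power: "(\<lambda>n. (\<Sum>j<n. Y j) / real n powr rho) \<longlonglongrightarrow> L / mB"
proof -
  have "(\<Sum>j<n. Y j) \<le> K n" for n
  proof -
    have "(\<Sum>j<n. Y j) \<le> K n - K 0"
      by (induction n) (use BY_bounds(3) K in \<open>auto intro: order_trans[OF add_mono]\<close>)
    then show ?thesis using K0 by linarith
  qed
  then have "(\<lambda>n. (\<Sum>j<n. Y j * (muB j - mB)) / K n) \<longlonglongrightarrow> 0"
    using muB XY(2) by (intro toeplitz_null K_at_top) (auto simp: LIM_zero_iff)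
  moreover have "(\<lambda>n. (\<Sum>j<n. K j * ((B j - muB j) * Y j / K j)) / K n) \<longlonglongrightarrow> 0"
    using K0 by (intro kronecker_null D3 incseq_K K_at_top) auto
  moreover have "(\<lambda>n. K 0 / K n) \<longlonglongrightarrow> 0"
    by (intro tendsto_divide_0[OF tendsto_const] filterlim_at_top_imp_at_infinity K_at_top)
  ultimately have "(\<lambda>n. (1 - K 0 / K n - (\<Sum>j<n. Y j * (muB j - mB)) / K n
      - (\<Sum>j<n. K j * ((B j - muB j) * Y j / K j)) / K n) / mB * (K n / real n powr rho))
      \<longlonglongrightarrow> (1 - 0 - 0 - 0) / mB * L"
    using mB by (intro tendsto_intros K_power) auto
  moreover have "(1 - K 0 / K n - (\<Sum>j<n. Y j * (muB j - mB)) / K n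
      - (\<Sum>j<n. K j * ((B j - muB j) * Y j / K j)) / K n) / mB * (K n / real n powr rho)
      = (\<Sum>j<n. Y j) / real n powr rho" for n
  proof -
    have "K n - K 0 - (\<Sum>j<n. Y j * (muB j - mB)) - (\<Sum>j<n. K j * ((B j - muB j) * Y j / K j))
        = mB * (\<Sum>j<n. Y j)"
    proof (induction n)
      case (Suc n)
      moreover have "K n * ((B n - muB n) * Y n / K n) = (B n - muB n) * Y n"
        using K_ge[of n] by simp
      ultimately show ?case by (simp add: K algebra_simps del: times_divide_eq_right)
    qed simp
    then have "(1 - K 0 / K n - (\<Sum>j<n. Y j * (muB j - mB)) / K n
      - (\<Sum>j<n. K j * ((B j - muB j) * Y j / K j)) / K n) = mB * (\<Sum>j<n. Y j) / K n"
      using K_ge[of n] by (subst (asm) eq_commute) (simp add: diff_divide_distrib del: times_divide_eq_right)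
    then show ?thesis using K_ge[of n] mB by simp
  qed
  ultimately show ?thesis by simp
qed

end

section \<open>Convergence of square-integrable martingales\<close>

lemma integrable_mult_of_squares:
  fixes f g :: "'a \<Rightarrow> real"
  assumes [measurable]: "f \<in> borel_measurable M" "g \<in> borel_measurable M"
    and "integrable M (\<lambda>\<omega>. (f \<omega>)\<^sup>2)" "integrable M (\<lambda>\<omega>. (g \<omega>)\<^sup>2)"
  shows "integrable M (\<lambda>\<omega>. f \<omega> * g \<omega>)"
proof (rule Bochner_Integration.integrable_bound)
  show "integrable M (\<lambda>\<omega>. (f \<omega>)\<^sup>2 + (g \<omega>)\<^sup>2)" using assms by simp
  have "\<bar>x * y\<bar> \<le> x\<^sup>2 + y\<^sup>2" for x y :: real
  proof -
    have "2 * \<bar>x\<bar> * \<bar>y\<bar> \<le> \<bar>x\<bar>\<^sup>2 + \<bar>y\<bar>\<^sup>2" by (rule sum_squares_bound)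
    moreover have "0 \<le> \<bar>x\<bar> * \<bar>y\<bar>" by simp
    ultimately show ?thesis unfolding abs_mult power2_abs by linarith
  qed
  then show "AE \<omega> in M. norm (f \<omega> * g \<omega>) \<le> norm ((f \<omega>)\<^sup>2 + (g \<omega>)\<^sup>2)" by simp
qed simp

text \<open>\<open>D n\<close> is the increment from time \<open>n\<close> to \<open>n + 1\<close>.
  The martingale property is stated as vanishing integrals over the events of \<open>F n\<close>,
  the form in which the urn calculations deliver it.\<close>

locale square_integrable_martingale_differences = prob_space M
  for M :: "'w measure" +
  fixes F :: "nat \<Rightarrow> 'w measure" and D :: "nat \<Rightarrow> 'w \<Rightarrow> real"
  assumes subalgebra_F: "\<And>n. subalgebra M (F n)"
    and F_Suc: "\<And>n. sets (F n) \<subseteq> sets (F (Suc n))"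
    and D_adapted: "\<And>n. D n \<in> borel_measurable (F (Suc n))"
    and D_square: "\<And>n. integrable M (\<lambda>\<omega>. (D n \<omega>)\<^sup>2)"
    and D_centered: "\<And>n E. E \<in> sets (F n) \<Longrightarrow> (\<integral>\<omega>. indicator E \<omega> * D n \<omega> \<partial>M) = 0"
begin

lemma space_F: "space (F n) = space M"
  using subalgebra_F[of n] by (simp add: subalgebra_def)

lemma F_mono: "m \<le> n \<Longrightarrow> sets (F m) \<subseteq> sets (F n)"
  by (rule lift_Suc_mono_le[of "\<lambda>n. sets (F n)"]) (use F_Suc in auto)

lemma measurable_F_mono:
  assumes "m \<le> n" "f \<in> borel_measurable (F m)"
  shows "f \<in> borel_measurable (F n)"
  by (rule measurable_from_subalg[OF _ assms(2)])
    (use F_mono[OF assms(1)] in \<open>simp add: subalgebra_def space_F\<close>)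

lemma measurable_F_M: "f \<in> borel_measurable (F n) \<Longrightarrow> f \<in> borel_measurable M"
  by (rule measurable_from_subalg[OF subalgebra_F])

lemma D_measurable [measurable]: "D n \<in> borel_measurable M"
  by (rule measurable_F_M[OF D_adapted])

lemma D_integrable: "integrable M (D n)"
  by (rule square_integrable_imp_integrable[OF _ D_square]) simp

text \<open>Vanishing integrals over all events of \<open>F n\<close> identify the conditional
  expectation of \<open>D n\<close> as 0, and this extends the orthogonality from indicators to
  square-integrable \<open>W\<close>.\<close>

lemma D_orthogonal:
  assumes W: "W \<in> borel_measurable (F n)" "integrable M (\<lambda>\<omega>. (W \<omega>)\<^sup>2)"
  shows "(\<integral>\<omega>. W \<omega> * D n \<omega> \<partial>M) = 0"
proof -
  interpret finite_measure_subalgebra M "F n" by unfold_locales (rule subalgebra_F)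
  have "AE \<omega> in M. real_cond_exp M (F n) (D n) \<omega> = 0"
    by (rule real_cond_exp_charact)
      (auto simp: set_lebesgue_integral_def D_centered D_integrable)
  moreover have "(\<integral>\<omega>. W \<omega> * real_cond_exp M (F n) (D n) \<omega> \<partial>M) = (\<integral>\<omega>. W \<omega> * D n \<omega> \<partial>M)"
    by (intro real_cond_exp_intg(2) integrable_mult_of_squares measurable_F_M[OF W(1)] D_square W D_measurable)
  ultimately show ?thesis
    by (subst (asm) integral_cong_AE[where g = "\<lambda>_. 0"])
      (auto intro!: borel_measurable_times measurable_F_M[OF W(1)] borel_measurable_cond_exp2)
qed

lemma maximal_inequality:
  assumes e: "0 < e"
  shows "prob {\<omega>\<in>space M. \<exists>k\<le>n. e \<le> \<bar>\<Sum>j<k. D j \<omega>\<bar>} \<le> (\<Sum>j<n. \<integral>\<omega>. (D j \<omega>)\<^sup>2 \<partial>M) / e\<^sup>2"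
proof -
  define bad where "bad n \<omega> \<longleftrightarrow> (\<exists>k\<le>n. e \<le> \<bar>\<Sum>j<k. D j \<omega>\<bar>)" for n \<omega>
  define W where "W n \<omega> = (if bad n \<omega> then 0 else 1 :: real)" for n \<omega>
  \<comment> \<open>\<open>T\<close> is the martingale stopped when it first leaves \<open>(-e, e)\<close>, so Chebyshev at time \<open>n\<close> suffices.\<close>
  define T where "T n \<omega> = (\<Sum>j<n. W j \<omega> * D j \<omega>)" for n \<omega>
  \<comment> \<open>The sum below \<open>k\<close> ends with \<open>D (k - 1)\<close> and is known
    at time \<open>k\<close>. Hence \<open>W n\<close> is known before the increment
    \<open>D n\<close>, as the orthogonality argument requires.\<close>
  have partial: "(\<lambda>\<omega>. \<Sum>j<k. D j \<omega>) \<in> borel_measurable (F n)" if "k \<le> n" for k n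
    using that by (intro borel_measurable_sum measurable_F_mono[OF _ D_adapted]) auto
  have bad_meas: "Measurable.pred (F n) (bad n)" for n
  proof -
    have [measurable]: "k \<in> {..n} \<Longrightarrow> (\<lambda>\<omega>. \<Sum>j<k. D j \<omega>) \<in> borel_measurable (F n)" for k
      using partial by simp
    have "bad n = (\<lambda>\<omega>. \<exists>k\<in>{..n}. e \<le> \<bar>\<Sum>j<k. D j \<omega>\<bar>)" by (auto simp: bad_def fun_eq_iff)
    moreover have "Measurable.pred (F n) (\<lambda>\<omega>. \<exists>k\<in>{..n}. e \<le> \<bar>\<Sum>j<k. D j \<omega>\<bar>)"
      by (rule pred_intros_finite) measurable
    ultimately show ?thesis by simp
  qed
  have W_meas: "W n \<in> borel_measurable (F n)" for n
    unfolding W_def using bad_meas[of n] by measurable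
  have T_meas: "T n \<in> borel_measurable (F n)" for n
    unfolding T_def
    by (intro borel_measurable_sum borel_measurable_times measurable_F_mono[OF _ D_adapted]
        measurable_F_mono[OF _ W_meas]) auto
  have WD: "(\<lambda>\<omega>. (W n \<omega> * D n \<omega>)\<^sup>2) \<in> borel_measurable M"
    "integrable M (\<lambda>\<omega>. (W n \<omega> * D n \<omega>)\<^sup>2)" for n
  proof -
    show m: "(\<lambda>\<omega>. (W n \<omega> * D n \<omega>)\<^sup>2) \<in> borel_measurable M"
      using measurable_F_M[OF W_meas[of n]] by measurable
    show "integrable M (\<lambda>\<omega>. (W n \<omega> * D n \<omega>)\<^sup>2)"
      by (rule Bochner_Integration.integrable_bound[OF D_square[of n] m]) (auto simp: W_def)
  qed
  \<comment> \<open>\<open>T n * W n\<close> is known at time \<open>n\<close>, so the cross term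
    integrates to 0. Since \<open>W\<close> is 0 or 1, each step adds at most the second moment of
    \<open>D n\<close>.\<close>
  have T: "integrable M (\<lambda>\<omega>. (T n \<omega>)\<^sup>2) \<and> (\<integral>\<omega>. (T n \<omega>)\<^sup>2 \<partial>M) \<le> (\<Sum>j<n. \<integral>\<omega>. (D j \<omega>)\<^sup>2 \<partial>M)" for n
  proof (induction n)
    case 0 then show ?case by (simp add: T_def)
  next
    case (Suc n)
    have sq: "(T (Suc n) \<omega>)\<^sup>2 = (T n \<omega>)\<^sup>2 + 2 * (T n \<omega> * W n \<omega> * D n \<omega>) + (W n \<omega> * D n \<omega>)\<^sup>2" for \<omega>
      by (simp add: T_def power2_sum algebra_simps)
    have TW: "(\<lambda>\<omega>. T n \<omega> * W n \<omega>) \<in> borel_measurable (F n)"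
      by (intro borel_measurable_times T_meas W_meas)
    have TW2: "integrable M (\<lambda>\<omega>. (T n \<omega> * W n \<omega>)\<^sup>2)"
    proof (rule Bochner_Integration.integrable_bound)
      show "integrable M (\<lambda>\<omega>. (T n \<omega>)\<^sup>2)" using Suc by simp
      show "(\<lambda>\<omega>. (T n \<omega> * W n \<omega>)\<^sup>2) \<in> borel_measurable M"
        by (intro borel_measurable_power measurable_F_M[OF TW])
    qed (auto simp: W_def)
    have cross: "integrable M (\<lambda>\<omega>. T n \<omega> * W n \<omega> * D n \<omega>)"
      by (intro integrable_mult_of_squares measurable_F_M[OF TW] D_measurable TW2 D_square)
    have "(\<integral>\<omega>. (T (Suc n) \<omega>)\<^sup>2 \<partial>M) = (\<integral>\<omega>. (T n \<omega>)\<^sup>2 \<partial>M) + (\<integral>\<omega>. (W n \<omega> * D n \<omega>)\<^sup>2 \<partial>M)"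
      unfolding sq using Suc cross WD(2)[of n] D_orthogonal[OF TW TW2] by simp
    also have "(\<integral>\<omega>. (W n \<omega> * D n \<omega>)\<^sup>2 \<partial>M) \<le> (\<integral>\<omega>. (D n \<omega>)\<^sup>2 \<partial>M)"
      by (intro integral_mono WD(2) D_square) (auto simp: W_def)
    finally show ?case unfolding sq using Suc cross WD(2)[of n] by simp
  qed
  \<comment> \<open>After the first exit all later weights vanish, so \<open>T\<close> keeps its
    exit value even if the unstopped sum returns below \<open>e\<close>.\<close>
  have path: "(\<not> bad n \<omega> \<longrightarrow> T n \<omega> = (\<Sum>j<n. D j \<omega>)) \<and> (bad n \<omega> \<longrightarrow> e \<le> \<bar>T n \<omega>\<bar>)" for n \<omega>
  proof (induction n)
    case 0 then show ?case using e by (simp add: T_def bad_def)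
  next
    case (Suc n)
    have b: "bad (Suc n) \<omega> \<longleftrightarrow> bad n \<omega> \<or> e \<le> \<bar>\<Sum>j<Suc n. D j \<omega>\<bar>"
      unfolding bad_def by (auto simp: le_Suc_eq simp del: sum.lessThan_Suc)
    have "T (Suc n) \<omega> = T n \<omega> + W n \<omega> * D n \<omega>" by (simp add: T_def)
    then show ?case using Suc b by (cases "bad n \<omega>") (auto simp: W_def)
  qed
  have "prob {\<omega>\<in>space M. bad n \<omega>} \<le> prob {\<omega>\<in>space M. e \<le> \<bar>T n \<omega>\<bar>}"
    using path measurable_F_M[OF T_meas[of n]] by (intro finite_measure_mono) auto
  also have "\<dots> \<le> (\<integral>\<omega>. (T n \<omega>)\<^sup>2 \<partial>M) / e\<^sup>2"
    using T e by (intro second_moment_method measurable_F_M[OF T_meas]) auto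
  also have "\<dots> \<le> (\<Sum>j<n. \<integral>\<omega>. (D j \<omega>)\<^sup>2 \<partial>M) / e\<^sup>2"
    using T by (intro divide_right_mono) auto
  finally show ?thesis unfolding bad_def .
qed

lemma maximal_inequality_infinite:
  assumes e: "0 < e" and s: "summable (\<lambda>j. \<integral>\<omega>. (D j \<omega>)\<^sup>2 \<partial>M)"
  shows "prob {\<omega>\<in>space M. \<exists>k. e \<le> \<bar>\<Sum>j<k. D j \<omega>\<bar>} \<le> (\<Sum>j. \<integral>\<omega>. (D j \<omega>)\<^sup>2 \<partial>M) / e\<^sup>2"
proof -
  define E where "E n = {\<omega>\<in>space M. \<exists>k\<le>n. e \<le> \<bar>\<Sum>j<k. D j \<omega>\<bar>}" for n
  have "(\<lambda>n. prob (E n)) \<longlonglongrightarrow> prob (\<Union>n. E n)"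
  proof (rule finite_Lim_measure_incseq)
    show "range E \<subseteq> events" unfolding E_def by auto
    show "incseq E" unfolding E_def by (auto simp: incseq_def intro: order_trans)
  qed
  moreover have "(\<Union>n. E n) = {\<omega>\<in>space M. \<exists>k. e \<le> \<bar>\<Sum>j<k. D j \<omega>\<bar>}"
    unfolding E_def by auto
  moreover have "prob (E n) \<le> (\<Sum>j. \<integral>\<omega>. (D j \<omega>)\<^sup>2 \<partial>M) / e\<^sup>2" for n
  proof -
    have "prob (E n) \<le> (\<Sum>j<n. \<integral>\<omega>. (D j \<omega>)\<^sup>2 \<partial>M) / e\<^sup>2"
      unfolding E_def by (rule maximal_inequality[OF e])
    also have "\<dots> \<le> (\<Sum>j. \<integral>\<omega>. (D j \<omega>)\<^sup>2 \<partial>M) / e\<^sup>2"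
      by (intro divide_right_mono sum_le_suminf s) auto
    finally show ?thesis .
  qed
  ultimately show ?thesis by (auto intro: LIMSEQ_le_const2)
qed

text \<open>Restarting at time \<open>m\<close> lets the maximal inequality control the oscillation
  of the tail.\<close>

lemma shifted:
  "square_integrable_martingale_differences M (\<lambda>n. F (n + m)) (\<lambda>n. D (n + m))"
  by unfold_locales (use subalgebra_F F_Suc D_adapted D_square D_centered in auto)

text \<open>If the sums restarted at every \<open>m\<close> reach \<open>e\<close>, then the event
  is contained in events whose probabilities are bounded by tails of the variance series, divided by
  the square of \<open>e\<close>. So for each \<open>e\<close> some restarted sequence stays below
  \<open>e\<close>; letting \<open>e\<close> run through \<open>1 / (r + 1)\<close> makes almost
  every path Cauchy.\<close>

theorem AE_summable:
  assumes s: "summable (\<lambda>j. \<integral>\<omega>. (D j \<omega>)\<^sup>2 \<partial>M)"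
  shows "AE \<omega> in M. summable (\<lambda>j. D j \<omega>)"
proof -
  have osc: "AE \<omega> in M. \<exists>m. \<forall>k. \<bar>\<Sum>j<k. D (j + m) \<omega>\<bar> < e" if e: "0 < e" for e
  proof -
    define Q where "Q m = {\<omega>\<in>space M. \<exists>k. e \<le> \<bar>\<Sum>j<k. D (j + m) \<omega>\<bar>}" for m
    have Q [measurable]: "Q m \<in> events" for m unfolding Q_def by measurable
    have "(\<lambda>m. (\<Sum>j. \<integral>\<omega>. (D (j + m) \<omega>)\<^sup>2 \<partial>M) / e\<^sup>2) \<longlonglongrightarrow> 0 / e\<^sup>2"
      using e by (intro tendsto_intros suminf_exist_split2[OF s]) auto
    moreover have "prob (\<Inter>m. Q m) \<le> (\<Sum>j. \<integral>\<omega>. (D (j + m) \<omega>)\<^sup>2 \<partial>M) / e\<^sup>2" for m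
    proof -
      interpret sh: square_integrable_martingale_differences M "\<lambda>n. F (n + m)" "\<lambda>n. D (n + m)"
        by (rule shifted)
      have "prob (\<Inter>m. Q m) \<le> prob (Q m)" by (intro finite_measure_mono) auto
      also have "\<dots> \<le> (\<Sum>j. \<integral>\<omega>. (D (j + m) \<omega>)\<^sup>2 \<partial>M) / e\<^sup>2"
        unfolding Q_def
        by (intro sh.maximal_inequality_infinite e summable_ignore_initial_segment[OF s])
      finally show ?thesis .
    qed
    ultimately have "prob (\<Inter>m. Q m) \<le> 0 / e\<^sup>2" by (auto intro: LIMSEQ_le_const)
    then have "prob (\<Inter>m. Q m) = 0" by (simp add: measure_le_0_iff)
    then have "AE \<omega> in M. \<omega> \<notin> (\<Inter>m. Q m)"
      by (subst (asm) prob_eq_0) auto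
    then show ?thesis
      by (rule AE_mp) (auto simp: Q_def not_le)
  qed
  have "AE \<omega> in M. \<forall>r. \<exists>m. \<forall>k. \<bar>\<Sum>j<k. D (j + m) \<omega>\<bar> < inverse (real (Suc r))"
    using osc by (subst AE_all_countable) auto
  then show ?thesis
  proof (rule AE_mp, intro AE_I2 impI)
    fix \<omega> assume h: "\<forall>r. \<exists>m. \<forall>k. \<bar>\<Sum>j<k. D (j + m) \<omega>\<bar> < inverse (real (Suc r))"
    have "\<exists>m. \<forall>i\<ge>m. norm ((\<Sum>j<i. D j \<omega>) - (\<Sum>j<m. D j \<omega>)) < e" if e: "0 < e" for e
    proof -
      obtain r where r: "inverse (real (Suc r)) < e" using reals_Archimedean[OF e] by auto
      obtain m where m: "\<And>k. \<bar>\<Sum>j<k. D (j + m) \<omega>\<bar> < inverse (real (Suc r))" using h by blast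
      have "(\<Sum>j<i. D j \<omega>) - (\<Sum>j<m. D j \<omega>) = (\<Sum>j<i - m. D (j + m) \<omega>)" if "m \<le> i" for i
      proof -
        have "(\<Sum>j<i. D j \<omega>) = (\<Sum>j<m. D j \<omega>) + (\<Sum>j=m..<i. D j \<omega>)"
          using that by (metis atLeast0LessThan le0 sum.atLeastLessThan_concat)
        also have "(\<Sum>j=m..<i. D j \<omega>) = (\<Sum>j<i - m. D (j + m) \<omega>)"
          using sum.shift_bounds_nat_ivl[of "\<lambda>j. D j \<omega>" 0 m "i - m"] that by (simp add: atLeast0LessThan)
        finally show ?thesis by simp
      qed
      then show ?thesis using m r by (metis less_trans real_norm_def)
    qed
    then have "Cauchy (\<lambda>n. \<Sum>j<n. D j \<omega>)"
      by (auto simp: Cauchy_altdef2 dist_norm)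
    then show "summable (\<lambda>j. D j \<omega>)"
      by (simp add: summable_iff_convergent Cauchy_convergent_iff)
  qed
qed

end

text \<open>Domination by relative increments of a growing sequence and by
  \<open>1 / (n + 1)\<close> bounds the sum of squared increments by one constant on almost every
  path. This yields square integrability of each increment and, after integration, summable
  variances.\<close>

lemma (in prob_space) AE_summable_martingale_increments:
  assumes F: "\<And>n. subalgebra M (F n)" "\<And>n. sets (F n) \<subseteq> sets (F (Suc n))"
    and D: "\<And>n. D n \<in> borel_measurable (F (Suc n))"
    and D0: "\<And>n E. E \<in> sets (F n) \<Longrightarrow> (\<integral>\<omega>. indicator E \<omega> * D n \<omega> \<partial>M) = 0"
    and G: "AE \<omega> in M. 1 \<le> (G 0 \<omega> :: real) \<and> (\<forall>n. G (Suc n) \<omega> = G n \<omega> + x n \<omega> \<and> 0 \<le> x n \<omega> \<and> x n \<omega> \<le> c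
        \<and> \<bar>D n \<omega>\<bar> \<le> c * (x n \<omega> / G n \<omega>) + c / (real n + 1))"
  shows "AE \<omega> in M. summable (\<lambda>n. D n \<omega>)"
proof -
  \<comment> \<open>From the bound of a squared sum by twice the sum of the squares: the first
    summand uses the telescoping estimate \<open>c * (1 + c)\<close>, the second the convergent
    series of inverse squares.\<close>
  define R where "R = 2 * c\<^sup>2 * (c * (1 + c)) + 2 * c\<^sup>2 * (\<Sum>j. 1 / (real j + 1)\<^sup>2)"
  have inv: "summable (\<lambda>j. 1 / (real j + 1)\<^sup>2)"
    using inverse_squares_sums by (auto simp: sums_iff add.commute)
  have [measurable]: "D n \<in> borel_measurable M" for n
    by (rule measurable_from_subalg[OF F(1) D])
  have sumD: "AE \<omega> in M. \<forall>n. (\<Sum>j<n. (D j \<omega>)\<^sup>2) \<le> R"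
    using G
  proof eventually_elim
    case (elim \<omega>)
    show ?case
    proof
      fix n
      have "(D j \<omega>)\<^sup>2 \<le> 2 * c\<^sup>2 * (x j \<omega> / G j \<omega>)\<^sup>2 + 2 * c\<^sup>2 * (1 / (real j + 1)\<^sup>2)" for j
      proof -
        have "(D j \<omega>)\<^sup>2 \<le> (c * (x j \<omega> / G j \<omega>) + c / (real j + 1))\<^sup>2"
          using elim by (intro abs_le_square_iff[THEN iffD1] order_trans[OF _ abs_ge_self]) auto
        also have "\<dots> \<le> 2 * (c * (x j \<omega> / G j \<omega>))\<^sup>2 + 2 * (c / (real j + 1))\<^sup>2"
          using sum_squares_bound[of "c * (x j \<omega> / G j \<omega>)" "c / (real j + 1)"] by (simp add: power2_sum)
        finally show ?thesis by (simp add: power_mult_distrib power_divide)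
      qed
      then have "(\<Sum>j<n. (D j \<omega>)\<^sup>2)
          \<le> (\<Sum>j<n. 2 * c\<^sup>2 * (x j \<omega> / G j \<omega>)\<^sup>2 + 2 * c\<^sup>2 * (1 / (real j + 1)\<^sup>2))"
        by (intro sum_mono)
      also have "\<dots> = 2 * c\<^sup>2 * (\<Sum>j<n. (x j \<omega> / G j \<omega>)\<^sup>2) + 2 * c\<^sup>2 * (\<Sum>j<n. 1 / (real j + 1)\<^sup>2)"
        by (simp only: sum.distrib sum_distrib_left)
      also have "\<dots> \<le> R"
        unfolding R_def using elim
        by (intro add_mono mult_left_mono sum_le_suminf[OF inv] sum_square_increments_le[where G = "\<lambda>n. G n \<omega>"]) auto
      finally show "(\<Sum>j<n. (D j \<omega>)\<^sup>2) \<le> R" .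
    qed
  qed
  have sq: "integrable M (\<lambda>\<omega>. (D n \<omega>)\<^sup>2)" for n
  proof (rule integrable_const_bound[where B = R])
    show "AE \<omega> in M. norm ((D n \<omega>)\<^sup>2) \<le> R"
      using sumD
    proof eventually_elim
      case (elim \<omega>)
      have "(D n \<omega>)\<^sup>2 \<le> (\<Sum>j<Suc n. (D j \<omega>)\<^sup>2)" by (simp add: sum_nonneg)
      also have "\<dots> \<le> R" using elim by blast
      finally show ?case by simp
    qed
  qed simp
  interpret square_integrable_martingale_differences M F D
    by unfold_locales (use F D D0 sq in auto)
  show ?thesis
  proof (rule AE_summable, rule summableI_nonneg_bounded)
    fix n
    have "(\<Sum>j<n. \<integral>\<omega>. (D j \<omega>)\<^sup>2 \<partial>M) = (\<integral>\<omega>. (\<Sum>j<n. (D j \<omega>)\<^sup>2) \<partial>M)"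
      by (rule Bochner_Integration.integral_sum[symmetric]) (rule sq)
    also have "\<dots> \<le> (\<integral>\<omega>. R \<partial>M)"
      using sumD by (intro integral_mono_AE Bochner_Integration.integrable_sum sq) auto
    finally show "(\<Sum>j<n. \<integral>\<omega>. (D j \<omega>)\<^sup>2 \<partial>M) \<le> R" by (simp add: prob_space)
  qed simp
qed

section \<open>The urn process\<close>

text \<open>Absorbing \<open>k\<close> into \<open>h choose k\<close> lowers both arguments by one,
  and Vandermonde's identity sums the rest. The range reaches up to an arbitrary
  \<open>c \<ge> n\<close> so that a fixed range can serve for a random sample size.\<close>

lemma hypergeometric_mean:
  assumes "1 \<le> n" "n \<le> s" "h \<le> s" "n \<le> c"
  shows "(\<Sum>k\<le>c. real k * hypergeometric n s h k) = real n * real h / real s"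
proof -
  obtain m where m: "n = Suc m" using assms(1) by (cases n) auto
  obtain t where t: "s = Suc t" using assms m by (cases s) auto
  have pos: "0 < s choose n" using assms by simp
  have abs: "(\<Sum>k\<le>n. k * ((h choose k) * ((s - h) choose (n - k)))) = h * (t choose m)"
  proof (cases h)
    case 0 then show ?thesis by (auto simp: binomial_eq_0 intro!: sum.neutral)
  next
    case (Suc g)
    have "(\<Sum>k\<le>n. k * ((h choose k) * ((s - h) choose (n - k))))
        = (\<Sum>k\<le>m. Suc k * (h choose Suc k) * ((s - h) choose (m - k)))"
      unfolding m by (subst sum.atMost_Suc_shift) (simp add: mult.assoc del: mult_Suc)
    also have "\<dots> = (\<Sum>k\<le>m. h * ((g choose k) * ((s - h) choose (m - k))))"
      unfolding Suc by (intro sum.cong) (simp_all only: Suc_times_binomial mult.assoc)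
    also have "\<dots> = h * ((g + (s - h)) choose m)"
      by (simp only: sum_distrib_left[symmetric] vandermonde)
    also have "g + (s - h) = t" using Suc t assms by simp
    finally show ?thesis .
  qed
  have "n * (s choose n) = s * (t choose m)"
    unfolding m t by (rule Suc_times_binomial)
  then have "real n * real (s choose n) = real s * real (t choose m)"
    by (metis of_nat_mult)
  then have ratio: "real (t choose m) / real (s choose n) = real n / real s"
    using pos t by (subst frac_eq_eq) (simp_all add: mult.commute del: of_nat_Suc)
  \<comment> \<open>Terms with \<open>k > n\<close> vanish by the default value in
    \<open>hypergeometric\<close>.\<close>
  have "(\<Sum>k\<le>c. real k * hypergeometric n s h k) = (\<Sum>k\<le>n. real k * hypergeometric n s h k)"
    using assms by (intro sum.mono_neutral_right) (auto simp: hypergeometric_def)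
  also have "\<dots> = (\<Sum>k\<le>n. real (k * ((h choose k) * ((s - h) choose (n - k)))) / real (s choose n))"
    by (intro sum.cong) (auto simp: hypergeometric_def)
  also have "\<dots> = real (\<Sum>k\<le>n. k * ((h choose k) * ((s - h) choose (n - k)))) / real (s choose n)"
    by (simp add: sum_divide_distrib)
  also have "\<dots> = real h * (real (t choose m) / real (s choose n))"
    unfolding abs by simp
  finally show ?thesis unfolding ratio by (simp add: mult.commute)
qed

section \<open>Discrete variables and the generated sigma-algebras\<close>

lemma measurable_Pair_count_space:
  fixes f :: "'w \<Rightarrow> 'b :: countable" and g :: "'w \<Rightarrow> 'c :: countable"
  assumes "f \<in> measurable M (count_space UNIV)" "g \<in> measurable M (count_space UNIV)"
  shows "(\<lambda>\<omega>. (f \<omega>, g \<omega>)) \<in> measurable M (count_space UNIV)"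
  using measurable_Pair[OF assms] by (simp add: pair_measure_countable)

lemma preimages_eq_sets: "preimages M Y = sets (vimage_algebra (space M) Y (count_space UNIV))"
  by (subst sets_vimage_algebra2) (auto simp: preimages_def)

lemma preimages_subset_sets:
  "Y \<in> measurable M (count_space UNIV) \<Longrightarrow> preimages M Y \<subseteq> sets M"
  by (auto simp: preimages_def intro!: measurable_sets)

lemma measurable_of_preimages:
  fixes Y :: "'w \<Rightarrow> 'b"
  assumes "preimages M Y \<subseteq> sets F" "space F = space M"
  shows "Y \<in> measurable F (count_space UNIV)"
proof (rule measurableI)
  fix T assume "T \<in> sets (count_space (UNIV :: 'b set))"
  have "Y -` T \<inter> space M \<in> preimages M Y" by (auto simp: preimages_def)
  then show "Y -` T \<inter> space F \<in> sets F" using assms by auto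
qed simp

locale bounded_urn = urn_model M a b N X A B
  for M :: "'w measure" and a b N X A B +
  fixes C :: nat
  assumes bounded: "\<And>n. AE \<omega> in M. max (A (Suc n) \<omega>) (max (B (Suc n) \<omega>) (N (Suc n) \<omega>)) \<le> C"
begin

abbreviation "F \<equiv> urn_F M N X A B"
abbreviation "H \<equiv> urn_H a X A"
abbreviation "K \<equiv> urn_K b N X B"
abbreviation "S \<equiv> urn_S a b N X A B"
abbreviation "G n \<equiv> join_sigma (F n) (N (Suc n))"
abbreviation "G' n \<equiv> join_sigma (F n) (\<lambda>\<omega>. (N (Suc n) \<omega>, X (Suc n) \<omega>))"

declare N_measurable [measurable] X_measurable [measurable]
  A_measurable [measurable] B_measurable [measurable]

lemma step_measurable:
  assumes "1 \<le> j"
  shows "(\<lambda>\<omega>. (N j \<omega>, X j \<omega>, A j \<omega>, B j \<omega>)) \<in> measurable M (count_space UNIV)"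
proof -
  obtain i where "j = Suc i" using assms by (cases j) auto
  then show ?thesis by (simp add: measurable_Pair_count_space)
qed

lemma space_F [simp]: "space (F n) = space M"
  unfolding urn_F_def by (intro space_measure_of) (auto simp: preimages_def)

lemma sets_F: "sets (F n) = sigma_sets (space M)
    (\<Union>j\<in>{1..n}. preimages M (\<lambda>\<omega>. (N j \<omega>, X j \<omega>, A j \<omega>, B j \<omega>)))"
  unfolding urn_F_def by (intro sets_measure_of) (auto simp: preimages_def)

lemma subalgebra_F: "subalgebra M (F n)"
  unfolding subalgebra_def sets_F
  by (auto intro!: sets.sigma_sets_subset UN_least preimages_subset_sets step_measurable simp del: UN_iff)

lemma F_Suc: "sets (F n) \<subseteq> sets (F (Suc n))"
  unfolding sets_F by (intro sigma_sets_mono' UN_mono) auto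

lemma measurable_F_step:
  assumes "1 \<le> j" "j \<le> n"
  shows "(\<lambda>\<omega>. g (N j \<omega>, X j \<omega>, A j \<omega>, B j \<omega>)) \<in> borel_measurable (F n)"
proof -
  have "(\<lambda>\<omega>. (N j \<omega>, X j \<omega>, A j \<omega>, B j \<omega>)) \<in> measurable (F n) (count_space UNIV)"
  proof (rule measurable_of_preimages)
    show "preimages M (\<lambda>\<omega>. (N j \<omega>, X j \<omega>, A j \<omega>, B j \<omega>)) \<subseteq> sets (F n)"
      unfolding sets_F using assms by (intro order_trans[OF _ sigma_sets_superset_generator] UN_upper) simp
  qed simp
  moreover have "g \<in> borel_measurable (count_space UNIV)" by simp
  ultimately show ?thesis by (rule measurable_compose)
qed

lemma H_measurable [measurable]: "(\<lambda>\<omega>. real (H n \<omega>)) \<in> borel_measurable (F n)"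
proof -
  have "(\<lambda>\<omega>. real (A j \<omega> * X j \<omega>)) \<in> borel_measurable (F n)" if "j \<in> {1..n}" for j
    using measurable_F_step[of j n "\<lambda>(n, x, a, b). real (a * x)"] that by simp
  then show ?thesis
    unfolding urn_H_def of_nat_add of_nat_sum
    by (intro borel_measurable_add borel_measurable_sum borel_measurable_const)
qed

lemma K_measurable [measurable]: "(\<lambda>\<omega>. real (K n \<omega>)) \<in> borel_measurable (F n)"
proof -
  have "(\<lambda>\<omega>. real (B j \<omega> * (N j \<omega> - X j \<omega>))) \<in> borel_measurable (F n)" if "j \<in> {1..n}" for j
    using measurable_F_step[of j n "\<lambda>(n, x, a, b). real (b * (n - x))"] that by simp
  then show ?thesis
    unfolding urn_K_def of_nat_add of_nat_sum
    by (intro borel_measurable_add borel_measurable_sum borel_measurable_const)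
qed

lemma S_measurable [measurable]: "(\<lambda>\<omega>. real (S n \<omega>)) \<in> borel_measurable (F n)"
  unfolding urn_S_def of_nat_add by measurable

lemma F_to_M: "f \<in> borel_measurable (F n) \<Longrightarrow> f \<in> borel_measurable M"
  by (rule measurable_from_subalg[OF subalgebra_F])

lemma F_to_Suc: "f \<in> borel_measurable (F n) \<Longrightarrow> f \<in> borel_measurable (F (Suc n))"
  by (rule measurable_from_subalg[of "F (Suc n)" "F n"]) (use F_Suc in \<open>auto simp: subalgebra_def\<close>)

lemma HKS_measurable [measurable]:
  "(\<lambda>\<omega>. real (H n \<omega>)) \<in> borel_measurable M" "(\<lambda>\<omega>. real (K n \<omega>)) \<in> borel_measurable M"
  "(\<lambda>\<omega>. real (S n \<omega>)) \<in> borel_measurable M"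
  by (auto intro: F_to_M H_measurable K_measurable S_measurable)

lemma join_sigma_properties:
  assumes Y: "Y \<in> measurable M (count_space UNIV)"
  shows "subalgebra M (join_sigma (F n) Y)" "sets (F n) \<subseteq> sets (join_sigma (F n) Y)"
    "Y \<in> measurable (join_sigma (F n) Y) (count_space UNIV)"
    "f \<in> borel_measurable (F n) \<Longrightarrow> f \<in> borel_measurable (join_sigma (F n) Y)"
proof -
  have pre: "preimages (F n) Y = preimages M Y" by (simp add: preimages_def)
  have sub: "sets (F n) \<union> preimages M Y \<subseteq> Pow (space M)"
    using sets.sets_into_space[of _ "F n"] by (auto simp: preimages_def)
  have sp: "space (join_sigma (F n) Y) = space M"
    and st: "sets (join_sigma (F n) Y) = sigma_sets (space M) (sets (F n) \<union> preimages M Y)"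
    unfolding join_sigma_def pre using sub by (simp_all add: space_measure_of sets_measure_of)
  show s: "subalgebra M (join_sigma (F n) Y)"
    unfolding subalgebra_def sp st using subalgebra_F[of n] preimages_subset_sets[OF Y]
    by (auto simp: subalgebra_def intro!: sets.sigma_sets_subset)
  show F: "sets (F n) \<subseteq> sets (join_sigma (F n) Y)" unfolding st by auto
  show "Y \<in> measurable (join_sigma (F n) Y) (count_space UNIV)"
    by (rule measurable_of_preimages[OF _ sp]) (auto simp: st)
  show "f \<in> borel_measurable (join_sigma (F n) Y)" if "f \<in> borel_measurable (F n)"
    by (rule measurable_from_subalg[OF _ that]) (use F sp in \<open>auto simp: subalgebra_def\<close>)
qed

lemmas G_properties = join_sigma_properties[where n = n, OF N_measurable[of n]] for n
lemmas G'_properties =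
  join_sigma_properties[where n = n, OF measurable_Pair_count_space[OF N_measurable[of n] X_measurable[of n]]] for n

section \<open>From conditional laws to integrals and almost sure ranges\<close>

lemma integral_cond_pr:
  assumes "subalgebra M \<G>" "W \<in> borel_measurable \<G>" "\<And>\<omega>. \<bar>W \<omega>\<bar> \<le> c"
    and P: "{\<omega>\<in>space M. P \<omega>} \<in> events"
  shows "(\<integral>\<omega>. W \<omega> * indicat_real {\<omega>\<in>space M. P \<omega>} \<omega> \<partial>M) = (\<integral>\<omega>. W \<omega> * cond_pr M \<G> P \<omega> \<partial>M)"
    "integrable M (\<lambda>\<omega>. W \<omega> * cond_pr M \<G> P \<omega>)"
    "integrable M (\<lambda>\<omega>. W \<omega> * indicat_real {\<omega>\<in>space M. P \<omega>} \<omega>)"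
proof -
  interpret finite_measure_subalgebra M \<G> by unfold_locales (rule assms)
  have W: "W \<in> borel_measurable M" by (rule measurable_from_subalg[OF assms(1,2)])
  show i: "integrable M (\<lambda>\<omega>. W \<omega> * indicat_real {\<omega>\<in>space M. P \<omega>} \<omega>)"
    using W P assms(3)
    by (intro integrable_const_bound[where B = c])
      (auto simp: indicator_def intro: order_trans[OF abs_ge_zero])
  have m: "indicat_real {\<omega>\<in>space M. P \<omega>} \<in> borel_measurable M" using P by simp
  show "(\<integral>\<omega>. W \<omega> * indicat_real {\<omega>\<in>space M. P \<omega>} \<omega> \<partial>M) = (\<integral>\<omega>. W \<omega> * cond_pr M \<G> P \<omega> \<partial>M)"
    "integrable M (\<lambda>\<omega>. W \<omega> * cond_pr M \<G> P \<omega>)"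
    unfolding cond_pr_def using real_cond_exp_intg[OF i assms(2) m] by auto
qed

text \<open>The probability of \<open>E\<close> together with \<open>P\<close> is the integral over
  \<open>E\<close> of the conditional probability. This converts the conditional assumptions of the
  model into constraints on paths.\<close>

lemma AE_cond_pr_zero:
  assumes "subalgebra M \<G>" "E \<in> sets \<G>" and P: "{\<omega>\<in>space M. P \<omega>} \<in> events"
    and z: "AE \<omega> in M. \<omega> \<in> E \<longrightarrow> cond_pr M \<G> P \<omega> = 0"
  shows "AE \<omega> in M. \<not> (\<omega> \<in> E \<and> P \<omega>)"
proof -
  have E: "E \<in> events" using assms(1,2) by (auto simp: subalgebra_def)
  have i: "indicat_real E \<in> borel_measurable \<G>" using assms(2) by simp
  have b: "\<bar>indicat_real E \<omega>\<bar> \<le> 1" for \<omega> by (simp add: indicator_def)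
  have "(\<integral>\<omega>. indicat_real E \<omega> * cond_pr M \<G> P \<omega> \<partial>M) = (\<integral>\<omega>. 0 \<partial>M)"
    using z integral_cond_pr(2)[OF assms(1) i b P]
    by (intro integral_cong_AE) (auto simp: indicator_def)
  then have "(\<integral>\<omega>. indicat_real E \<omega> * indicat_real {\<omega>\<in>space M. P \<omega>} \<omega> \<partial>M) = 0"
    using integral_cond_pr(1)[OF assms(1) i b P] by simp
  also have "(\<lambda>\<omega>. indicat_real E \<omega> * indicat_real {\<omega>\<in>space M. P \<omega>} \<omega>)
      = indicat_real (E \<inter> {\<omega>\<in>space M. P \<omega>})" by (auto simp: indicator_def fun_eq_iff)
  finally have "prob (E \<inter> {\<omega>\<in>space M. P \<omega>}) = 0" using E P by simp
  then have "AE \<omega> in M. \<omega> \<notin> E \<inter> {\<omega>\<in>space M. P \<omega>}" using E P by (subst (asm) prob_eq_0) auto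
  then show ?thesis by (rule AE_mp) auto
qed

text \<open>The admissible range is itself random, so each value \<open>k\<close> is treated
  separately: the event that \<open>k\<close> lies outside the range belongs to \<open>F n\<close>,
  and there are countably many \<open>k\<close>.\<close>

lemma N_range: "AE \<omega> in M. 1 \<le> N (Suc n) \<omega> \<and> N (Suc n) \<omega> \<le> S n \<omega>"
proof -
  have "AE \<omega> in M. \<forall>k. \<not> (\<omega> \<in> {\<omega>\<in>space M. k \<notin> {1..S n \<omega>}} \<and> N (Suc n) \<omega> = k)"
  proof (subst AE_all_countable, intro allI AE_cond_pr_zero[OF subalgebra_F])
    fix k
    have "{\<omega>\<in>space M. k \<notin> {1..S n \<omega>}} = {\<omega>\<in>space (F n). \<not> (1 \<le> k \<and> real k \<le> real (S n \<omega>))}" by auto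
    also have "\<dots> \<in> sets (F n)" by measurable
    finally show "{\<omega>\<in>space M. k \<notin> {1..S n \<omega>}} \<in> sets (F n)" .
    show "{\<omega>\<in>space M. N (Suc n) \<omega> = k} \<in> events" by measurable
    show "AE \<omega> in M. \<omega> \<in> {\<omega>\<in>space M. k \<notin> {1..S n \<omega>}} \<longrightarrow>
        cond_pr M (F n) (\<lambda>\<omega>'. N (Suc n) \<omega>' = k) \<omega> = 0"
      using N_concentrated[of n] by eventually_elim auto
  qed
  then show ?thesis by (rule AE_mp) (auto simp: Suc_le_eq)
qed

text \<open>The hypergeometric weight is 0 beyond the sample size, and the event
  \<open>N (Suc n) \<omega> < k\<close> belongs to the conditioning sigma-algebra
  \<open>G n\<close>.\<close>

lemma X_le_N: "AE \<omega> in M. X (Suc n) \<omega> \<le> N (Suc n) \<omega>"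
proof -
  have "AE \<omega> in M. \<forall>k. \<not> (\<omega> \<in> {\<omega>\<in>space M. N (Suc n) \<omega> < k} \<and> X (Suc n) \<omega> = k)"
  proof (subst AE_all_countable, intro allI AE_cond_pr_zero[OF G_properties(1)])
    fix k
    have [measurable]: "N (Suc n) \<in> measurable (G n) (count_space UNIV)" by (rule G_properties(3))
    have "space (G n) = space M" using G_properties(1)[of n] by (simp add: subalgebra_def)
    then have "{\<omega>\<in>space M. N (Suc n) \<omega> < k} = {\<omega>\<in>space (G n). N (Suc n) \<omega> < k}" by simp
    also have "\<dots> \<in> sets (G n)" by measurable
    finally show "{\<omega>\<in>space M. N (Suc n) \<omega> < k} \<in> sets (G n)" .
    show "{\<omega>\<in>space M. X (Suc n) \<omega> = k} \<in> events" by measurable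
    show "AE \<omega> in M. \<omega> \<in> {\<omega>\<in>space M. N (Suc n) \<omega> < k} \<longrightarrow>
        cond_pr M (G n) (\<lambda>\<omega>'. X (Suc n) \<omega>' = k) \<omega> = 0"
      using X_hypergeometric[of n] by eventually_elim (auto simp: hypergeometric_def)
  qed
  then show ?thesis by (rule AE_mp) (auto simp: not_less)
qed

text \<open>Collects the constraints of all times in one event of full probability, on which the
  deterministic results apply path by path.\<close>

definition regular :: "'w \<Rightarrow> bool" where
  "regular \<omega> \<longleftrightarrow> (\<forall>n. 1 \<le> N (Suc n) \<omega> \<and> N (Suc n) \<omega> \<le> S n \<omega> \<and> N (Suc n) \<omega> \<le> C
    \<and> X (Suc n) \<omega> \<le> N (Suc n) \<omega> \<and> 1 \<le> A (Suc n) \<omega> \<and> A (Suc n) \<omega> \<le> C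
    \<and> 1 \<le> B (Suc n) \<omega> \<and> B (Suc n) \<omega> \<le> C)"

lemma AE_regular: "AE \<omega> in M. regular \<omega>"
  unfolding regular_def
proof (subst AE_all_countable, intro allI)
  fix n
  show "AE \<omega> in M. 1 \<le> N (Suc n) \<omega> \<and> N (Suc n) \<omega> \<le> S n \<omega> \<and> N (Suc n) \<omega> \<le> C
    \<and> X (Suc n) \<omega> \<le> N (Suc n) \<omega> \<and> 1 \<le> A (Suc n) \<omega> \<and> A (Suc n) \<omega> \<le> C
    \<and> 1 \<le> B (Suc n) \<omega> \<and> B (Suc n) \<omega> \<le> C"
    using N_range[of n] X_le_N[of n] AB_positive[of n] bounded[of n] by eventually_elim auto
qed

lemma H_pos: "1 \<le> H n \<omega>" and K_pos: "1 \<le> K n \<omega>"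
  using a_ge_1 b_ge_1 by (auto simp: urn_H_def urn_K_def)

lemma integrable_draws:
  assumes [measurable]: "W \<in> borel_measurable M" and c: "\<And>\<omega>. \<bar>W \<omega>\<bar> \<le> c"
  shows "integrable M (\<lambda>\<omega>. W \<omega> * real (X (Suc n) \<omega>))"
    "integrable M (\<lambda>\<omega>. W \<omega> * (real (N (Suc n) \<omega>) - real (X (Suc n) \<omega>)))"
    "integrable M (\<lambda>\<omega>. W \<omega> * real (N (Suc n) \<omega>))"
    "integrable M (\<lambda>\<omega>. W \<omega> * (real (N (Suc n) \<omega>) * real (H n \<omega>) / real (S n \<omega>)))"
    "integrable M (\<lambda>\<omega>. W \<omega> * (real (N (Suc n) \<omega>) * real (K n \<omega>) / real (S n \<omega>)))"
proof -
  have bnd: "AE \<omega> in M. norm (W \<omega> * f \<omega>) \<le> c * real C" if "AE \<omega> in M. 0 \<le> f \<omega> \<and> f \<omega> \<le> real C" for f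
    using that
  proof eventually_elim
    case (elim \<omega>)
    then show ?case unfolding norm_mult using c[of \<omega>] by (intro mult_mono) auto
  qed
  have r: "AE \<omega> in M. X (Suc n) \<omega> \<le> N (Suc n) \<omega> \<and> N (Suc n) \<omega> \<le> C"
    using AE_regular by eventually_elim (auto simp: regular_def)
  have q: "x * y / z \<le> x" if "0 \<le> x" "0 \<le> y" "y \<le> z" for x y z :: real
    using that mult_left_mono[of "y / z" 1 x] by (cases "z = 0") (auto simp: divide_le_eq_1)
  show "integrable M (\<lambda>\<omega>. W \<omega> * real (X (Suc n) \<omega>))"
    "integrable M (\<lambda>\<omega>. W \<omega> * (real (N (Suc n) \<omega>) - real (X (Suc n) \<omega>)))"
    "integrable M (\<lambda>\<omega>. W \<omega> * real (N (Suc n) \<omega>))"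
    by (rule integrable_const_bound[OF bnd[OF eventually_mono[OF r]]], force, measurable)+
  have "AE \<omega> in M. 0 \<le> real (N (Suc n) \<omega>) * real (H n \<omega>) / real (S n \<omega>) \<and>
      real (N (Suc n) \<omega>) * real (H n \<omega>) / real (S n \<omega>) \<le> real C"
    using r
  proof eventually_elim
    case (elim \<omega>)
    then show ?case using q[of "real (N (Suc n) \<omega>)" "real (H n \<omega>)" "real (S n \<omega>)"]
      by (auto simp: urn_S_def intro: order_trans)
  qed
  then show "integrable M (\<lambda>\<omega>. W \<omega> * (real (N (Suc n) \<omega>) * real (H n \<omega>) / real (S n \<omega>)))"
    by (intro integrable_const_bound[OF bnd]) measurable
  have "AE \<omega> in M. 0 \<le> real (N (Suc n) \<omega>) * real (K n \<omega>) / real (S n \<omega>) \<and>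
      real (N (Suc n) \<omega>) * real (K n \<omega>) / real (S n \<omega>) \<le> real C"
    using r
  proof eventually_elim
    case (elim \<omega>)
    then show ?case using q[of "real (N (Suc n) \<omega>)" "real (K n \<omega>)" "real (S n \<omega>)"]
      by (auto simp: urn_S_def intro: order_trans)
  qed
  then show "integrable M (\<lambda>\<omega>. W \<omega> * (real (N (Suc n) \<omega>) * real (K n \<omega>) / real (S n \<omega>)))"
    by (intro integrable_const_bound[OF bnd]) measurable
qed

text \<open>Boundedness makes \<open>X\<close> a finite combination of the indicators of
  \<open>X = k\<close> with \<open>k \<le> C\<close>. Each indicator is exchanged for its
  conditional probability given \<open>G n\<close>, and the hypergeometric mean collects the
  sum.\<close>

lemma expectation_X:
  assumes W: "W \<in> borel_measurable (F n)" and c: "\<And>\<omega>. \<bar>W \<omega>\<bar> \<le> c"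
  shows "(\<integral>\<omega>. W \<omega> * real (X (Suc n) \<omega>) \<partial>M)
    = (\<integral>\<omega>. W \<omega> * (real (N (Suc n) \<omega>) * real (H n \<omega>) / real (S n \<omega>)) \<partial>M)"
proof -
  let ?I = "\<lambda>k. indicat_real {\<omega>\<in>space M. X (Suc n) \<omega> = k}"
  let ?P = "\<lambda>k. cond_pr M (G n) (\<lambda>\<omega>. X (Suc n) \<omega> = k)"
  have WM [measurable]: "W \<in> borel_measurable M" by (rule F_to_M[OF W])
  have ev: "{\<omega>\<in>space M. X (Suc n) \<omega> = k} \<in> events" for k by measurable
  note cp = integral_cond_pr[OF G_properties(1) G_properties(4)[OF W] c ev]
  have "(\<integral>\<omega>. W \<omega> * real (X (Suc n) \<omega>) \<partial>M) = (\<integral>\<omega>. (\<Sum>k\<le>C. real k * (W \<omega> * ?I k \<omega>)) \<partial>M)"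
  proof (rule integral_cong_AE)
    show "AE \<omega> in M. W \<omega> * real (X (Suc n) \<omega>) = (\<Sum>k\<le>C. real k * (W \<omega> * ?I k \<omega>))"
      using AE_regular AE_space
    proof eventually_elim
      case (elim \<omega>)
      have XC: "X (Suc n) \<omega> \<le> C" using elim(1) unfolding regular_def by (meson order_trans)
      have "(\<Sum>k\<le>C. real k * (W \<omega> * ?I k \<omega>)) = (\<Sum>k\<le>C. if k = X (Suc n) \<omega> then real k * W \<omega> else 0)"
        using elim by (intro sum.cong) (auto simp: indicator_def)
      also have "\<dots> = real (X (Suc n) \<omega>) * W \<omega>"
        using XC by (subst sum.delta) auto
      finally show ?case by simp
    qed
  qed measurable
  also have "\<dots> = (\<Sum>k\<le>C. real k * (\<integral>\<omega>. W \<omega> * ?I k \<omega> \<partial>M))"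
    using cp(3) by (subst Bochner_Integration.integral_sum) auto
  also have "\<dots> = (\<Sum>k\<le>C. real k * (\<integral>\<omega>. W \<omega> * ?P k \<omega> \<partial>M))"
    by (simp only: cp(1))
  also have "\<dots> = (\<integral>\<omega>. (\<Sum>k\<le>C. real k * (W \<omega> * ?P k \<omega>)) \<partial>M)"
    using cp(2) by (subst Bochner_Integration.integral_sum) auto
  also have "\<dots> = (\<integral>\<omega>. W \<omega> * (real (N (Suc n) \<omega>) * real (H n \<omega>) / real (S n \<omega>)) \<partial>M)"
  proof (rule integral_cong_AE)
    show "(\<lambda>\<omega>. \<Sum>k\<le>C. real k * (W \<omega> * ?P k \<omega>)) \<in> borel_measurable M"
      using borel_measurable_integrable[OF cp(2)] by (intro borel_measurable_sum borel_measurable_times[OF borel_measurable_const]) auto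
    show "AE \<omega> in M. (\<Sum>k\<le>C. real k * (W \<omega> * ?P k \<omega>))
        = W \<omega> * (real (N (Suc n) \<omega>) * real (H n \<omega>) / real (S n \<omega>))"
      using AE_regular X_hypergeometric[of n]
    proof eventually_elim
      case (elim \<omega>)
      have "(\<Sum>k\<le>C. real k * (W \<omega> * ?P k \<omega>))
          = W \<omega> * (\<Sum>k\<le>C. real k * hypergeometric (N (Suc n) \<omega>) (S n \<omega>) (H n \<omega>) k)"
        unfolding sum_distrib_left using elim(2) by (intro sum.cong) auto
      also have "(\<Sum>k\<le>C. real k * hypergeometric (N (Suc n) \<omega>) (S n \<omega>) (H n \<omega>) k)
          = real (N (Suc n) \<omega>) * real (H n \<omega>) / real (S n \<omega>)"
        using elim(1) by (intro hypergeometric_mean) (auto simp: regular_def urn_S_def)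
      finally show ?case .
    qed
  qed measurable
  finally show ?thesis .
qed

lemma expectation_N_minus_X:
  assumes W: "W \<in> borel_measurable (F n)" and c: "\<And>\<omega>. \<bar>W \<omega>\<bar> \<le> c"
  shows "(\<integral>\<omega>. W \<omega> * (real (N (Suc n) \<omega>) - real (X (Suc n) \<omega>)) \<partial>M)
    = (\<integral>\<omega>. W \<omega> * (real (N (Suc n) \<omega>) * real (K n \<omega>) / real (S n \<omega>)) \<partial>M)"
proof -
  note i = integrable_draws[OF F_to_M[OF W] c, of n]
  have "real (H n \<omega>) / real (S n \<omega>) + real (K n \<omega>) / real (S n \<omega>) = 1" for \<omega>
    using H_pos[of n \<omega>] by (simp add: urn_S_def add_divide_distrib[symmetric])
  then have "real (N (Suc n) \<omega>) = real (N (Suc n) \<omega>) * (real (H n \<omega>) / real (S n \<omega>) + real (K n \<omega>) / real (S n \<omega>))" for \<omega>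
    by simp
  then have s: "W \<omega> * real (N (Suc n) \<omega>) = W \<omega> * (real (N (Suc n) \<omega>) * real (H n \<omega>) / real (S n \<omega>))
      + W \<omega> * (real (N (Suc n) \<omega>) * real (K n \<omega>) / real (S n \<omega>))" for \<omega>
    by (metis distrib_left times_divide_eq_right)
  have "(\<integral>\<omega>. W \<omega> * (real (N (Suc n) \<omega>) - real (X (Suc n) \<omega>)) \<partial>M)
      = (\<integral>\<omega>. W \<omega> * real (N (Suc n) \<omega>) \<partial>M) - (\<integral>\<omega>. W \<omega> * real (X (Suc n) \<omega>) \<partial>M)"
    unfolding right_diff_distrib using i by (intro Bochner_Integration.integral_diff)
  also have "(\<integral>\<omega>. W \<omega> * real (N (Suc n) \<omega>) \<partial>M)
      = (\<integral>\<omega>. W \<omega> * (real (N (Suc n) \<omega>) * real (H n \<omega>) / real (S n \<omega>)) \<partial>M)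
      + (\<integral>\<omega>. W \<omega> * (real (N (Suc n) \<omega>) * real (K n \<omega>) / real (S n \<omega>)) \<partial>M)"
    unfolding s using i by (intro Bochner_Integration.integral_add)
  finally show ?thesis using expectation_X[OF W c] by simp
qed

text \<open>The sigma-algebras generated by \<open>V\<close> and by the function of the replacement
  pair are contained in the two independent families of the model, so their expectations
  factor.\<close>

lemma expectation_mult_indep:
  fixes g :: "nat \<times> nat \<Rightarrow> real"
  assumes V: "V \<in> borel_measurable (G' n)" "integrable M V"
    and g: "integrable M (\<lambda>\<omega>. g (A (Suc n) \<omega>, B (Suc n) \<omega>))"
  shows "(\<integral>\<omega>. V \<omega> * g (A (Suc n) \<omega>, B (Suc n) \<omega>) \<partial>M) = (\<integral>\<omega>. V \<omega> \<partial>M) * (\<integral>\<omega>. g (A (Suc n) \<omega>, B (Suc n) \<omega>) \<partial>M)"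
    "integrable M (\<lambda>\<omega>. V \<omega> * g (A (Suc n) \<omega>, B (Suc n) \<omega>))"
proof -
  let ?g = "\<lambda>\<omega>. g (A (Suc n) \<omega>, B (Suc n) \<omega>)" and ?AB = "\<lambda>\<omega>. (A (Suc n) \<omega>, B (Suc n) \<omega>)"
  have sp: "space (G' n) = space M" using G'_properties(1)[of n] by (simp add: subalgebra_def)
  have 1: "sigma_sets (space M) {V -` E \<inter> space M |E. E \<in> sets borel} \<subseteq> sets (G' n)"
    unfolding sp[symmetric] using V(1) by (intro sets.sigma_sets_subset) (auto intro: measurable_sets)
  \<comment> \<open>The preimages of all sets already form a sigma-algebra, so passing to the
    generated one does not leave them.\<close>
  have 2: "sigma_sets (space M) {?g -` E \<inter> space M |E. E \<in> sets borel} \<subseteq> preimages M ?AB"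
  proof -
    have "{?g -` E \<inter> space M |E. E \<in> sets borel} \<subseteq> preimages M ?AB"
    proof safe
      fix E :: "real set"
      have "?g -` E \<inter> space M = ?AB -` (g -` E) \<inter> space M" by auto
      then show "?g -` E \<inter> space M \<in> preimages M ?AB" unfolding preimages_def by blast
    qed
    then show ?thesis
      using sets.sigma_sets_subset[of _ "vimage_algebra (space M) ?AB (count_space UNIV)"]
      by (simp add: preimages_eq_sets)
  qed
  have "indep_set (sigma_sets (space M) {V -` E \<inter> space M |E. E \<in> sets borel})
      (sigma_sets (space M) {?g -` E \<inter> space M |E. E \<in> sets borel})"
    unfolding indep_sets2_eq
  proof (intro conjI ballI)
    note ind = AB_indep[of n, unfolded indep_sets2_eq]
    show "sigma_sets (space M) {V -` E \<inter> space M |E. E \<in> sets borel} \<subseteq> events"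
      using 1 ind by blast
    show "sigma_sets (space M) {?g -` E \<inter> space M |E. E \<in> sets borel} \<subseteq> events"
      using 2 ind by blast
    fix U T assume "U \<in> sigma_sets (space M) {V -` E \<inter> space M |E. E \<in> sets borel}"
      "T \<in> sigma_sets (space M) {?g -` E \<inter> space M |E. E \<in> sets borel}"
    then have "prob (T \<inter> U) = prob T * prob U" using 1 2 ind by blast
    then show "prob (U \<inter> T) = prob U * prob T" by (simp only: Int_commute mult.commute)
  qed
  then have "indep_var borel V borel ?g"
    unfolding indep_var_eq using V(2) g by auto
  then show "(\<integral>\<omega>. V \<omega> * ?g \<omega> \<partial>M) = (\<integral>\<omega>. V \<omega> \<partial>M) * (\<integral>\<omega>. ?g \<omega> \<partial>M)" "integrable M (\<lambda>\<omega>. V \<omega> * ?g \<omega>)"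
    using V(2) g by (auto intro: indep_var_lebesgue_integral indep_var_integrable)
qed

text \<open>On a regular path \<open>X \<le> N\<close>, so the truncated subtraction in
  \<open>urn_K\<close> agrees with the real difference.\<close>

lemma regular_growth:
  assumes "regular \<omega>"
  shows "urn_growth (\<lambda>n. real (A (Suc n) \<omega>)) (\<lambda>n. real (B (Suc n) \<omega>)) (\<lambda>n. real (N (Suc n) \<omega>))
    (\<lambda>n. real (X (Suc n) \<omega>)) (\<lambda>n. real (N (Suc n) \<omega>) - real (X (Suc n) \<omega>))
    (\<lambda>n. real (H n \<omega>)) (\<lambda>n. real (K n \<omega>)) (\<lambda>n. real (S n \<omega>)) (real C)"
  using assms a_ge_1 b_ge_1
  by unfold_locales (auto simp: regular_def urn_H_def urn_K_def urn_S_def of_nat_diff)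

section \<open>Almost sure convergence of the four compensated series\<close>

abbreviation "muA n \<equiv> \<integral>\<omega>. real (A (Suc n) \<omega>) \<partial>M"
abbreviation "muB n \<equiv> \<integral>\<omega>. real (B (Suc n) \<omega>) \<partial>M"
abbreviation "nu n \<equiv> real_cond_exp M (F n) (\<lambda>\<omega>. real (N (Suc n) \<omega>))"

lemma integrable_AB: "integrable M (\<lambda>\<omega>. real (A (Suc n) \<omega>))" "integrable M (\<lambda>\<omega>. real (B (Suc n) \<omega>))"
    "integrable M (\<lambda>\<omega>. real (N (Suc n) \<omega>))"
  using AE_regular by (auto intro!: integrable_const_bound[where B = C] elim!: eventually_mono simp: regular_def)

lemma mean_bounds: "1 \<le> muA n" "muA n \<le> C" "1 \<le> muB n" "muB n \<le> C"
proof -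
  have "(\<integral>\<omega>. 1 \<partial>M) \<le> muA n" "(\<integral>\<omega>. 1 \<partial>M) \<le> muB n" "muA n \<le> (\<integral>\<omega>. real C \<partial>M)" "muB n \<le> (\<integral>\<omega>. real C \<partial>M)"
    using AE_regular
    by (auto intro!: integral_mono_AE integrable_AB elim!: eventually_mono simp: regular_def simp del: integral_const lebesgue_integral_const)
  then show "1 \<le> muA n" "muA n \<le> C" "1 \<le> muB n" "muB n \<le> C" by (auto simp: prob_space)
qed

lemma step_adapted: "(\<lambda>\<omega>. real (N (Suc n) \<omega>)) \<in> borel_measurable (F (Suc n))"
  "(\<lambda>\<omega>. real (X (Suc n) \<omega>)) \<in> borel_measurable (F (Suc n))"
  "(\<lambda>\<omega>. real (A (Suc n) \<omega>)) \<in> borel_measurable (F (Suc n))"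
  "(\<lambda>\<omega>. real (B (Suc n) \<omega>)) \<in> borel_measurable (F (Suc n))"
  using measurable_F_step[of "Suc n" "Suc n" "\<lambda>(n, x, a, b). real n"]
    measurable_F_step[of "Suc n" "Suc n" "\<lambda>(n, x, a, b). real x"]
    measurable_F_step[of "Suc n" "Suc n" "\<lambda>(n, x, a, b). real a"]
    measurable_F_step[of "Suc n" "Suc n" "\<lambda>(n, x, a, b). real b"] by auto

text \<open>One calculation for both colors: \<open>L\<close> is \<open>H\<close> or
  \<open>K\<close>, \<open>R\<close> is the number of balls of that color drawn, and
  \<open>g\<close> selects \<open>A\<close> or \<open>B\<close>. As \<open>L \<ge> 1\<close>, the
  quotient of an indicator by \<open>L\<close> is an admissible bounded weight. Independence
  extracts \<open>mu\<close>, and the mean of \<open>R\<close> contributes a factor \<open>L\<close>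
  that cancels the division.\<close>

lemma centered:
  fixes g r :: "nat \<times> nat \<Rightarrow> real" and n :: nat
  defines "R \<equiv> \<lambda>\<omega>. r (N (Suc n) \<omega>, X (Suc n) \<omega>)"
  assumes E: "E \<in> sets (F n)"
    and L: "L \<in> borel_measurable (F n)" "\<And>\<omega>. 1 \<le> L \<omega>"
    and R: "\<And>W. W \<in> borel_measurable (F n) \<Longrightarrow> (\<And>\<omega>. \<bar>W \<omega>\<bar> \<le> 1) \<Longrightarrow>
        integrable M (\<lambda>\<omega>. W \<omega> * R \<omega>) \<and>
        integrable M (\<lambda>\<omega>. W \<omega> * (real (N (Suc n) \<omega>) * L \<omega> / real (S n \<omega>))) \<and>
        (\<integral>\<omega>. W \<omega> * R \<omega> \<partial>M) = (\<integral>\<omega>. W \<omega> * (real (N (Suc n) \<omega>) * L \<omega> / real (S n \<omega>)) \<partial>M)"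
    and g: "integrable M (\<lambda>\<omega>. g (A (Suc n) \<omega>, B (Suc n) \<omega>))"
    and mu: "mu = (\<integral>\<omega>. g (A (Suc n) \<omega>, B (Suc n) \<omega>) \<partial>M)"
  shows "(\<integral>\<omega>. indicator E \<omega> * (g (A (Suc n) \<omega>, B (Suc n) \<omega>) * R \<omega> / L \<omega>
      - mu * real (N (Suc n) \<omega>) / real (S n \<omega>)) \<partial>M) = 0"
    "(\<integral>\<omega>. indicator E \<omega> * ((g (A (Suc n) \<omega>, B (Suc n) \<omega>) - mu) * R \<omega> / L \<omega>) \<partial>M) = 0"
proof -
  let ?g = "\<lambda>\<omega>. g (A (Suc n) \<omega>, B (Suc n) \<omega>)"
  define W where "W \<omega> = indicator E \<omega> / L \<omega>" for \<omega>
  have W: "W \<in> borel_measurable (F n)" unfolding W_def using E L(1) by measurable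
  have W1: "\<bar>W \<omega>\<bar> \<le> 1" for \<omega> using L(2)[of \<omega>] by (simp add: W_def indicator_def)
  note R = R[OF W W1]
  have "(\<lambda>\<omega>. W \<omega> * R \<omega>) \<in> borel_measurable (G' n)"
  proof (intro borel_measurable_times G'_properties(4)[OF W])
    have "r \<in> borel_measurable (count_space UNIV)" by simp
    from measurable_compose[OF G'_properties(3) this]
    show "R \<in> borel_measurable (G' n)" unfolding R_def .
  qed
  note ind = expectation_mult_indep[OF this conjunct1[OF R] g]
  have "(\<integral>\<omega>. indicator E \<omega> * (?g \<omega> * R \<omega> / L \<omega> - mu * real (N (Suc n) \<omega>) / real (S n \<omega>)) \<partial>M)
      = (\<integral>\<omega>. W \<omega> * R \<omega> * ?g \<omega> - mu * (W \<omega> * (real (N (Suc n) \<omega>) * L \<omega> / real (S n \<omega>))) \<partial>M)"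
  proof (rule Bochner_Integration.integral_cong[OF refl])
    fix \<omega>
    have "L \<omega> \<noteq> 0" using L(2)[of \<omega>] by linarith
    then show "indicator E \<omega> * (?g \<omega> * R \<omega> / L \<omega> - mu * real (N (Suc n) \<omega>) / real (S n \<omega>))
        = W \<omega> * R \<omega> * ?g \<omega> - mu * (W \<omega> * (real (N (Suc n) \<omega>) * L \<omega> / real (S n \<omega>)))"
      by (simp add: W_def right_diff_distrib mult_ac)
  qed
  also have "\<dots> = 0" using ind R by (simp add: mu del: times_divide_eq_right)
  finally show "(\<integral>\<omega>. indicator E \<omega> * (?g \<omega> * R \<omega> / L \<omega> - mu * real (N (Suc n) \<omega>) / real (S n \<omega>)) \<partial>M) = 0" .
  have "(\<integral>\<omega>. indicator E \<omega> * ((?g \<omega> - mu) * R \<omega> / L \<omega>) \<partial>M)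
      = (\<integral>\<omega>. W \<omega> * R \<omega> * ?g \<omega> - mu * (W \<omega> * R \<omega>) \<partial>M)"
    by (rule Bochner_Integration.integral_cong[OF refl])
      (simp add: W_def left_diff_distrib right_diff_distrib diff_divide_distrib mult_ac)
  also have "\<dots> = 0" using ind R by (simp add: mu)
  finally show "(\<integral>\<omega>. indicator E \<omega> * ((?g \<omega> - mu) * R \<omega> / L \<omega>) \<partial>M) = 0" .
qed

lemma X_moments:
  assumes W: "W \<in> borel_measurable (F n)" "\<And>\<omega>. \<bar>W \<omega>\<bar> \<le> 1"
  shows "integrable M (\<lambda>\<omega>. W \<omega> * real (X (Suc n) \<omega>)) \<and>
    integrable M (\<lambda>\<omega>. W \<omega> * (real (N (Suc n) \<omega>) * real (H n \<omega>) / real (S n \<omega>))) \<and>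
    (\<integral>\<omega>. W \<omega> * real (X (Suc n) \<omega>) \<partial>M)
      = (\<integral>\<omega>. W \<omega> * (real (N (Suc n) \<omega>) * real (H n \<omega>) / real (S n \<omega>)) \<partial>M)"
  using integrable_draws[OF F_to_M[OF W(1)] W(2)] expectation_X[OF W] by blast

lemma N_minus_X_moments:
  assumes W: "W \<in> borel_measurable (F n)" "\<And>\<omega>. \<bar>W \<omega>\<bar> \<le> 1"
  shows "integrable M (\<lambda>\<omega>. W \<omega> * (real (N (Suc n) \<omega>) - real (X (Suc n) \<omega>))) \<and>
    integrable M (\<lambda>\<omega>. W \<omega> * (real (N (Suc n) \<omega>) * real (K n \<omega>) / real (S n \<omega>))) \<and>
    (\<integral>\<omega>. W \<omega> * (real (N (Suc n) \<omega>) - real (X (Suc n) \<omega>)) \<partial>M)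
      = (\<integral>\<omega>. W \<omega> * (real (N (Suc n) \<omega>) * real (K n \<omega>) / real (S n \<omega>)) \<partial>M)"
  using integrable_draws[OF F_to_M[OF W(1)] W(2)] expectation_N_minus_X[OF W] by blast

lemma real_H_ge: "1 \<le> real (H n \<omega>)" and real_K_ge: "1 \<le> real (K n \<omega>)"
  using H_pos[of n \<omega>] K_pos[of n \<omega>] by simp_all

lemma AE_summable_H:
  "AE \<omega> in M. summable (\<lambda>n. real (A (Suc n) \<omega>) * real (X (Suc n) \<omega>) / real (H n \<omega>)
    - muA n * real (N (Suc n) \<omega>) / real (S n \<omega>))"
proof (rule AE_summable_martingale_increments[where F = F and G = "\<lambda>n \<omega>. real (H n \<omega>)"
      and x = "\<lambda>n \<omega>. real (A (Suc n) \<omega>) * real (X (Suc n) \<omega>)" and c = "real C * real C"])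
  show "(\<lambda>\<omega>. real (A (Suc n) \<omega>) * real (X (Suc n) \<omega>) / real (H n \<omega>)
    - muA n * real (N (Suc n) \<omega>) / real (S n \<omega>)) \<in> borel_measurable (F (Suc n))" for n
    by (intro borel_measurable_diff borel_measurable_divide borel_measurable_times
        borel_measurable_const step_adapted F_to_Suc[OF H_measurable] F_to_Suc[OF S_measurable])
  show "(\<integral>\<omega>. indicator E \<omega> * (real (A (Suc n) \<omega>) * real (X (Suc n) \<omega>) / real (H n \<omega>)
    - muA n * real (N (Suc n) \<omega>) / real (S n \<omega>)) \<partial>M) = 0" if "E \<in> sets (F n)" for n E
    using centered(1)[where g = "\<lambda>(i, j). real i" and r = "\<lambda>(i, j). real j", OF that H_measurable real_H_ge]
      X_moments[of _ n] integrable_AB(1)[of n] by simp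
  show "AE \<omega> in M. 1 \<le> real (H 0 \<omega>) \<and> (\<forall>n. real (H (Suc n) \<omega>) = real (H n \<omega>) + real (A (Suc n) \<omega>) * real (X (Suc n) \<omega>)
      \<and> 0 \<le> real (A (Suc n) \<omega>) * real (X (Suc n) \<omega>)
      \<and> real (A (Suc n) \<omega>) * real (X (Suc n) \<omega>) \<le> real C * real C
      \<and> \<bar>real (A (Suc n) \<omega>) * real (X (Suc n) \<omega>) / real (H n \<omega>) - muA n * real (N (Suc n) \<omega>) / real (S n \<omega>)\<bar>
      \<le> real C * real C * (real (A (Suc n) \<omega>) * real (X (Suc n) \<omega>) / real (H n \<omega>)) + real C * real C / (real n + 1))"
    using AE_regular
  proof eventually_elim
    case (elim \<omega>)
    interpret p: urn_growth "\<lambda>n. real (A (Suc n) \<omega>)" "\<lambda>n. real (B (Suc n) \<omega>)" "\<lambda>n. real (N (Suc n) \<omega>)"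
      "\<lambda>n. real (X (Suc n) \<omega>)" "\<lambda>n. real (N (Suc n) \<omega>) - real (X (Suc n) \<omega>)"
      "\<lambda>n. real (H n \<omega>)" "\<lambda>n. real (K n \<omega>)" "\<lambda>n. real (S n \<omega>)" "real C"
      by (rule regular_growth[OF elim])
    have "0 \<le> muA n" for n using mean_bounds(1)[of n] by linarith
    then show ?case using p.H0 p.H p.AX_bounds p.H_increment_bound mean_bounds(2) by blast
  qed
qed (rule subalgebra_F F_Suc)+

text \<open>Both series are dominated by the same relative increments of \<open>K\<close>, and both
  centering identities come from \<open>centered\<close>; hence the joint proof.\<close>

lemma AE_summable_K:
  "AE \<omega> in M. summable (\<lambda>n. real (B (Suc n) \<omega>) * (real (N (Suc n) \<omega>) - real (X (Suc n) \<omega>)) / real (K n \<omega>)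
    - muB n * real (N (Suc n) \<omega>) / real (S n \<omega>))"
  (is "AE \<omega> in M. summable (\<lambda>n. ?D n \<omega>)")
  and AE_summable_B:
  "AE \<omega> in M. summable (\<lambda>n. (real (B (Suc n) \<omega>) - muB n) * (real (N (Suc n) \<omega>) - real (X (Suc n) \<omega>)) / real (K n \<omega>))"
  (is "AE \<omega> in M. summable (\<lambda>n. ?D' n \<omega>)")
proof -
  let ?x = "\<lambda>n \<omega>. real (B (Suc n) \<omega>) * (real (N (Suc n) \<omega>) - real (X (Suc n) \<omega>))"
  have cen: "(\<integral>\<omega>. indicator E \<omega> * ?D n \<omega> \<partial>M) = 0" "(\<integral>\<omega>. indicator E \<omega> * ?D' n \<omega> \<partial>M) = 0"
    if "E \<in> sets (F n)" for n E
    using centered[where g = "\<lambda>(i, j). real j" and r = "\<lambda>(i, j). real i - real j", OF that K_measurable real_K_ge]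
      N_minus_X_moments[of _ n] integrable_AB(2)[of n] by simp_all
  have b: "AE \<omega> in M. 1 \<le> real (K 0 \<omega>) \<and> (\<forall>n. real (K (Suc n) \<omega>) = real (K n \<omega>) + ?x n \<omega>
      \<and> 0 \<le> ?x n \<omega> \<and> ?x n \<omega> \<le> real C * real C
      \<and> \<bar>?D n \<omega>\<bar> \<le> real C * real C * (?x n \<omega> / real (K n \<omega>)) + real C * real C / (real n + 1)
      \<and> \<bar>?D' n \<omega>\<bar> \<le> real C * real C * (?x n \<omega> / real (K n \<omega>)) + real C * real C / (real n + 1))"
    using AE_regular
  proof eventually_elim
    case (elim \<omega>)
    interpret p: urn_growth "\<lambda>n. real (A (Suc n) \<omega>)" "\<lambda>n. real (B (Suc n) \<omega>)" "\<lambda>n. real (N (Suc n) \<omega>)"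
      "\<lambda>n. real (X (Suc n) \<omega>)" "\<lambda>n. real (N (Suc n) \<omega>) - real (X (Suc n) \<omega>)"
      "\<lambda>n. real (H n \<omega>)" "\<lambda>n. real (K n \<omega>)" "\<lambda>n. real (S n \<omega>)" "real C"
      by (rule regular_growth[OF elim])
    have "0 \<le> muB n" for n using mean_bounds(3)[of n] by linarith
    then show ?case
      using p.K0 p.K p.BY_bounds(1,2) p.K_increment_bound p.B_fluctuation_bound mean_bounds(4) by blast
  qed
  show "AE \<omega> in M. summable (\<lambda>n. ?D n \<omega>)"
  proof (rule AE_summable_martingale_increments[where F = F and G = "\<lambda>n \<omega>. real (K n \<omega>)"
      and x = ?x and c = "real C * real C"])
    show "?D n \<in> borel_measurable (F (Suc n))" for n
      by (intro borel_measurable_diff borel_measurable_divide borel_measurable_times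
        borel_measurable_const step_adapted F_to_Suc[OF K_measurable] F_to_Suc[OF S_measurable])
    show "AE \<omega> in M. 1 \<le> real (K 0 \<omega>) \<and> (\<forall>n. real (K (Suc n) \<omega>) = real (K n \<omega>) + ?x n \<omega>
        \<and> 0 \<le> ?x n \<omega> \<and> ?x n \<omega> \<le> real C * real C
        \<and> \<bar>?D n \<omega>\<bar> \<le> real C * real C * (?x n \<omega> / real (K n \<omega>)) + real C * real C / (real n + 1))"
      using b by (rule eventually_mono) blast
  qed (rule subalgebra_F F_Suc cen(1), assumption?)+
  show "AE \<omega> in M. summable (\<lambda>n. ?D' n \<omega>)"
  proof (rule AE_summable_martingale_increments[where F = F and G = "\<lambda>n \<omega>. real (K n \<omega>)"
      and x = ?x and c = "real C * real C"])
    show "?D' n \<in> borel_measurable (F (Suc n))" for n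
      by (intro borel_measurable_diff borel_measurable_divide borel_measurable_times
        borel_measurable_const step_adapted F_to_Suc[OF K_measurable])
    show "AE \<omega> in M. 1 \<le> real (K 0 \<omega>) \<and> (\<forall>n. real (K (Suc n) \<omega>) = real (K n \<omega>) + ?x n \<omega>
        \<and> 0 \<le> ?x n \<omega> \<and> ?x n \<omega> \<le> real C * real C
        \<and> \<bar>?D' n \<omega>\<bar> \<le> real C * real C * (?x n \<omega> / real (K n \<omega>)) + real C * real C / (real n + 1))"
      using b by (rule eventually_mono) blast
  qed (rule subalgebra_F F_Suc cen(2), assumption?)+
qed

text \<open>A degenerate case of the martingale criterion, with constant \<open>G\<close> and zero
  \<open>x\<close>: \<open>N\<close> and its conditional mean lie between 1 and \<open>C\<close>, so
  the increments are at most \<open>C / (n + 1)\<close>.\<close>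

lemma AE_summable_N:
  "AE \<omega> in M. summable (\<lambda>n. (real (N (Suc n) \<omega>) - nu n \<omega>) / (real n + 1))"
proof (rule AE_summable_martingale_increments[where F = F and G = "\<lambda>_ _. 1" and x = "\<lambda>_ _. 0" and c = "real C"])
  show "(\<lambda>\<omega>. (real (N (Suc n) \<omega>) - nu n \<omega>) / (real n + 1)) \<in> borel_measurable (F (Suc n))" for n
    by (intro borel_measurable_diff borel_measurable_divide
        borel_measurable_const step_adapted F_to_Suc[OF borel_measurable_cond_exp])
  show "(\<integral>\<omega>. indicator E \<omega> * ((real (N (Suc n) \<omega>) - nu n \<omega>) / (real n + 1)) \<partial>M) = 0"
    if E: "E \<in> sets (F n)" for n E
  proof -
    interpret finite_measure_subalgebra M "F n" by unfold_locales (rule subalgebra_F)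
    have EM: "E \<in> events" using E subalgebra_F[of n] by (auto simp: subalgebra_def)
    have i: "integrable M (\<lambda>\<omega>. indicator E \<omega> * real (N (Suc n) \<omega>))" "integrable M (\<lambda>\<omega>. indicator E \<omega> * nu n \<omega>)"
      using integrable_mult_indicator[OF EM integrable_AB(3)[of n]]
        integrable_mult_indicator[OF EM real_cond_exp_int(1)[OF integrable_AB(3)[of n]]] by simp_all
    have "(\<integral>\<omega>. indicator E \<omega> * ((real (N (Suc n) \<omega>) - nu n \<omega>) / (real n + 1)) \<partial>M)
        = (\<integral>\<omega>. (indicator E \<omega> * real (N (Suc n) \<omega>) - indicator E \<omega> * nu n \<omega>) / (real n + 1) \<partial>M)"
      by (simp add: right_diff_distrib)
    also have "\<dots> = ((\<integral>\<omega>. indicator E \<omega> * real (N (Suc n) \<omega>) \<partial>M) - (\<integral>\<omega>. indicator E \<omega> * nu n \<omega> \<partial>M)) / (real n + 1)"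
      using i by simp
    also have "\<dots> = 0"
      using real_cond_exp_intA[OF integrable_AB(3)[of n] E] by (simp add: set_lebesgue_integral_def)
    finally show ?thesis .
  qed
  have "AE \<omega> in M. \<forall>n. 1 \<le> nu n \<omega> \<and> nu n \<omega> \<le> real C"
  proof (subst AE_all_countable, intro allI)
    fix n
    interpret finite_measure_subalgebra M "F n" by unfold_locales (rule subalgebra_F)
    have "AE \<omega> in M. 1 \<le> nu n \<omega>" "AE \<omega> in M. nu n \<omega> \<le> real C"
      by (intro real_cond_exp_ge_c real_cond_exp_le_c integrable_AB eventually_mono[OF AE_regular];
          simp add: regular_def)+
    then show "AE \<omega> in M. 1 \<le> nu n \<omega> \<and> nu n \<omega> \<le> real C" by eventually_elim simp
  qed
  with AE_regular show "AE \<omega> in M. 1 \<le> (1::real) \<and> (\<forall>n. (1::real) = 1 + 0 \<and> 0 \<le> (0::real) \<and> 0 \<le> real C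
      \<and> \<bar>(real (N (Suc n) \<omega>) - nu n \<omega>) / (real n + 1)\<bar> \<le> real C * (0 / 1) + real C / (real n + 1))"
  proof eventually_elim
    case (elim \<omega>)
    have "\<bar>(real (N (Suc n) \<omega>) - nu n \<omega>) / (real n + 1)\<bar> \<le> real C / (real n + 1)" for n
    proof -
      have "1 \<le> real (N (Suc n) \<omega>)" "real (N (Suc n) \<omega>) \<le> real C" "1 \<le> nu n \<omega>" "nu n \<omega> \<le> real C"
        using elim unfolding regular_def by (metis of_nat_1 of_nat_le_iff)+
      then have "\<bar>real (N (Suc n) \<omega>) - nu n \<omega>\<bar> \<le> real C" by linarith
      then show ?thesis by (simp add: abs_divide divide_right_mono)
    qed
    then show ?case by simp
  qed
qed (rule subalgebra_F F_Suc)+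

end

section \<open>Measurable limit variables and transfer to almost every path\<close>

theorem theorem3p1:
  fixes M :: "'w measure"
    and a b C :: nat
    and N X A B :: "nat \<Rightarrow> 'w \<Rightarrow> nat"
    and mA mB :: real
    and Nlim :: "'w \<Rightarrow> real"
  assumes "urn_model M a b N X A B"
    and "\<And>n. AE \<omega> in M. max (A (Suc n) \<omega>) (max (B (Suc n) \<omega>) (N (Suc n) \<omega>)) \<le> C"
    and "(\<lambda>n. \<integral>\<omega>. real (A n \<omega>) \<partial>M) \<longlonglongrightarrow> mA"
    and "(\<lambda>n. \<integral>\<omega>. real (B n \<omega>) \<partial>M) \<longlonglongrightarrow> mB"
    and "mA > mB"
    and "summable (\<lambda>n. \<bar>(\<integral>\<omega>. real (A (Suc n) \<omega>) \<partial>M) * mB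
                         - mA * (\<integral>\<omega>. real (B (Suc n) \<omega>) \<partial>M)\<bar> / real n)"
    and "Nlim \<in> borel_measurable M"
    and "AE \<omega> in M. 0 < Nlim \<omega>"
    and "AE \<omega> in M.
          (\<lambda>n. real_cond_exp M (urn_F M N X A B n) (\<lambda>\<omega>'. real (N (Suc n) \<omega>')) \<omega>)
            \<longlonglongrightarrow> Nlim \<omega>"
  shows "(AE \<omega> in M. incseq (\<lambda>n. urn_K b N X B n \<omega>) \<and>
            filterlim (\<lambda>n. urn_K b N X B n \<omega>) at_top sequentially) \<and>
         (\<exists>L \<in> borel_measurable M. (\<forall>\<omega>\<in>space M. 0 < L \<omega>) \<and>
            (AE \<omega> in M. (\<lambda>n. real (urn_K b N X B n \<omega>) / real n powr (mB / mA)) \<longlonglongrightarrow> L \<omega>)) \<and>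
         (\<exists>Zt \<in> borel_measurable M. (\<forall>\<omega>\<in>space M. 0 < Zt \<omega>) \<and>
            (AE \<omega> in M. (\<lambda>n. real n powr (1 - mB / mA) * (1 - urn_Z a b N X A B n \<omega>))
                          \<longlonglongrightarrow> Zt \<omega>) \<and>
            (AE \<omega> in M. (\<lambda>n. (\<Sum>j=1..n. real (N j \<omega>) - real (X j \<omega>)) / real n powr (mB / mA))
                          \<longlonglongrightarrow> mA / mB * Nlim \<omega> * Zt \<omega>))"
proof -
  interpret urn_model M a b N X A B by (rule assms(1))
  interpret bounded_urn M a b N X A B C by unfold_locales (rule assms(2))
  have limA: "muA \<longlonglongrightarrow> mA" and limB: "muB \<longlonglongrightarrow> mB"
    using LIMSEQ_Suc[OF assms(3)] LIMSEQ_Suc[OF assms(4)] by simp_all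
  \<comment> \<open>Positivity of \<open>mB\<close> is inherited from the replacement numbers, which
    are at least 1.\<close>
  have "1 \<le> mB" by (rule LIMSEQ_le_const[OF limB]) (use mean_bounds(3) in auto)
  then have mB: "0 < mB" and mA: "0 < mA" using assms(5) by auto
  \<comment> \<open>A pointwise \<open>lim\<close> makes the limit measurable before its existence
    is known; it is identified with the limit on the path later. The values 1 in \<open>L\<close>
    and \<open>Zt\<close> only affect a null set and make positivity hold everywhere.\<close>
  define l where "l \<omega> = lim (\<lambda>n. real (K n \<omega>) / real n powr (mB / mA))" for \<omega>
  define L where "L \<omega> = (if 0 < l \<omega> then l \<omega> else 1)" for \<omega>
  define Zt where "Zt \<omega> = (if 0 < Nlim \<omega> then L \<omega> / (mA * Nlim \<omega>) else 1)" for \<omega>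
  have [measurable]: "Nlim \<in> borel_measurable M" by (rule assms(7))
  have [measurable]: "l \<in> borel_measurable M" unfolding l_def by measurable
  have L [measurable]: "L \<in> borel_measurable M" unfolding L_def by measurable
  have Zt: "Zt \<in> borel_measurable M" unfolding Zt_def by measurable
  have L_pos: "0 < L \<omega>" for \<omega> by (simp add: L_def)
  have Zt_pos: "0 < Zt \<omega>" for \<omega> using L_pos[of \<omega>] mA by (simp add: Zt_def)
  have main: "AE \<omega> in M. filterlim (\<lambda>n. K n \<omega>) at_top sequentially
      \<and> (\<lambda>n. real (K n \<omega>) / real n powr (mB / mA)) \<longlonglongrightarrow> L \<omega>
      \<and> (\<lambda>n. real n powr (1 - mB / mA) * (1 - urn_Z a b N X A B n \<omega>)) \<longlonglongrightarrow> Zt \<omega>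
      \<and> (\<lambda>n. (\<Sum>j=1..n. real (N j \<omega>) - real (X j \<omega>)) / real n powr (mB / mA))
          \<longlonglongrightarrow> mA / mB * Nlim \<omega> * Zt \<omega>"
    using AE_regular AE_summable_H AE_summable_K AE_summable_B AE_summable_N assms(8,9)
  proof eventually_elim
    case (elim \<omega>)
    interpret g: urn_growth "\<lambda>n. real (A (Suc n) \<omega>)" "\<lambda>n. real (B (Suc n) \<omega>)" "\<lambda>n. real (N (Suc n) \<omega>)"
      "\<lambda>n. real (X (Suc n) \<omega>)" "\<lambda>n. real (N (Suc n) \<omega>) - real (X (Suc n) \<omega>)"
      "\<lambda>n. real (H n \<omega>)" "\<lambda>n. real (K n \<omega>)" "\<lambda>n. real (S n \<omega>)" "real C"
      by (rule regular_growth[OF elim(1)])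
    interpret p: urn_path "\<lambda>n. real (A (Suc n) \<omega>)" "\<lambda>n. real (B (Suc n) \<omega>)" "\<lambda>n. real (N (Suc n) \<omega>)"
      "\<lambda>n. real (X (Suc n) \<omega>)" "\<lambda>n. real (N (Suc n) \<omega>) - real (X (Suc n) \<omega>)"
      "\<lambda>n. real (H n \<omega>)" "\<lambda>n. real (K n \<omega>)" "\<lambda>n. real (S n \<omega>)" "real C"
      "\<lambda>n. nu n \<omega>" muA muB mA mB "Nlim \<omega>"
      by unfold_locales (fact elim limA limB mB assms(5,6))+
    have K: "(\<lambda>n. real (K n \<omega>) / real n powr (mB / mA)) \<longlonglongrightarrow> p.L"
      using p.K_power by (simp add: p.rho_def)
    then have "l \<omega> = p.L" unfolding l_def by (rule limI)
    then have L_eq: "L \<omega> = p.L" using p.L_pos by (simp add: L_def)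
    have Zt_eq: "Zt \<omega> = p.L / (mA * Nlim \<omega>)" using elim(6) by (simp add: Zt_def L_eq)
    \<comment> \<open>Since \<open>Zt\<close> is the limit of \<open>K / n powr rho\<close> divided
      by \<open>mA * Nlim\<close>, the stated constant is the limit that counting draws through
      \<open>K\<close> gives.\<close>
    have e: "mA / mB * Nlim \<omega> * Zt \<omega> = p.L / mB" using elim(6) mA mB by (simp add: Zt_eq)
    have e': "(\<Sum>j=1..n. real (N j \<omega>) - real (X j \<omega>)) = (\<Sum>j<n. real (N (Suc j) \<omega>) - real (X (Suc j) \<omega>))" for n
      by (rule sum.reindex_bij_witness[of _ Suc "\<lambda>j. j - 1"]) auto
    have "(\<lambda>n. (\<Sum>j=1..n. real (N j \<omega>) - real (X j \<omega>)) / real n powr (mB / mA))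
          \<longlonglongrightarrow> mA / mB * Nlim \<omega> * Zt \<omega>"
      using p.Y_power unfolding e e' p.rho_def .
    moreover have "(\<lambda>n. real n powr (1 - mB / mA) * (1 - urn_Z a b N X A B n \<omega>)) \<longlonglongrightarrow> Zt \<omega>"
      using p.one_minus_Z_power by (simp add: p.rho_def Zt_eq urn_Z_def)
    moreover have "filterlim (\<lambda>n. K n \<omega>) at_top sequentially"
      using p.K_at_top by (simp add: filterlim_sequentially_iff_filterlim_real)
    ultimately show ?case using K L_eq by simp
  qed
  have inc: "incseq (\<lambda>n. K n \<omega>)" for \<omega>
    by (rule incseq_SucI) (simp add: urn_K_def)
  show ?thesis
  proof (intro conjI)
    show "AE \<omega> in M. incseq (\<lambda>n. K n \<omega>) \<and> filterlim (\<lambda>n. K n \<omega>) at_top sequentially"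
      using main by eventually_elim (use inc in auto)
    show "\<exists>L\<in>borel_measurable M. (\<forall>\<omega>\<in>space M. 0 < L \<omega>) \<and>
            (AE \<omega> in M. (\<lambda>n. real (K n \<omega>) / real n powr (mB / mA)) \<longlonglongrightarrow> L \<omega>)"
      using main L_pos by (intro bexI[OF _ L] conjI) (auto elim: eventually_mono)
    show "\<exists>Zt\<in>borel_measurable M. (\<forall>\<omega>\<in>space M. 0 < Zt \<omega>) \<and>
            (AE \<omega> in M. (\<lambda>n. real n powr (1 - mB / mA) * (1 - urn_Z a b N X A B n \<omega>)) \<longlonglongrightarrow> Zt \<omega>) \<and>
            (AE \<omega> in M. (\<lambda>n. (\<Sum>j=1..n. real (N j \<omega>) - real (X j \<omega>)) / real n powr (mB / mA))
                          \<longlonglongrightarrow> mA / mB * Nlim \<omega> * Zt \<omega>)"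
      using main Zt_pos by (intro bexI[OF _ Zt] conjI) (auto elim: eventually_mono)
  qed
qed

end
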